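(* Let $g\ge0$, $n\ge1$ with $2g-2+n>0$ and fix $\chi\in\mathbb Z$. (1) The maximal elements of $\Sigma_{g,n}^\chi$ are exactly the general V-functions, i.e. those V-functions $\sigma$ such that $\mathcal D(\sigma)=\emptyset$. (2) The submaximal elements of $\Sigma^\chi_{g,n}$ are the V-functions $\sigma$ such that $\mathcal D(\sigma)$ is equal to one of the following: (a) $\{(e;h,A),(e;h,A)^c\}$ for $(e;h,A)\in\mathbb D_{g,n}$ with either $e=1$, or $\emptyset\subsetneq A\subsetneq[n]$, or $A=\emptyset$ and $2h-2+e\ge g$, or $A=[n]$ and $2h+e\le g$; (b) $\displaystyle W_\delta:=\bigcup_{\delta\mid(2h-2+e),\ e\ge2}\{(e;h,\emptyset),(e;h,\emptyset)^c\}$ for some $1\le\delta\le g-1$, where the union is over the $(e;h,\emptyset)\in\mathbb D_{g,n}$ with the indicated properties. Moreover, each subset $\{(e;h,A),(e;h,A)^c\}$ as in (a) and each subset $W_\delta$ as in (b) is the degeneracy subset of some element of $\Sigma_{g,n}^\chi$. (3) Every submaximal element of $\Sigma^\chi_{g,n}$ is dominated by exactly two maximal elements.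
   Context: With $[n]=\{1,\dots,n\}$ and $A^c=[n]\setminus A$, $\mathbb D_{g,n}$ is the set of triples $(e;h,A)$ with $e\in\mathbb Z_{>0}$, $0\le h\le g-e+1$, $A\subseteq[n]$, $2h-2+e+|A|>0$, $2g-2h-e+|A^c|>0$; $(e;h,A)^c:=(e;g-h-e+1,A^c)$. A triangle is a multiset of three elements $(e_i;h_i,A_i)$ of $\mathbb D_{g,n}$ with $e_1+e_2+e_3$ even, $e_i+e_j\ge e_k+2$ for $\{i,j,k\}=\{1,2,3\}$, $A_1\sqcup A_2\sqcup A_3=[n]$, $g=h_1+h_2+h_3+\frac{e_1+e_2+e_3}2-2$. $\Sigma^\chi_{g,n}$ is the set of V-functions of type $(g,n)$ and characteristic $\chi$, i.e. functions $\sigma:\mathbb D_{g,n}\to\mathbb Z$ with (1) $\sigma(x)+\sigma(x^c)-\chi\in\{0,1\}$ for all $x$ ($x$ is $\sigma$-degenerate if the value is $0$, nondegenerate otherwise); (2) for each triangle $[x_1,x_2,x_3]$: if two of its elements are degenerate so is the third, and $\sum\sigma(x_i)-\chi$ is in $\{1,2\}$, equal to $1$, or equal to $0$ according to whether none, exactly one, or all of the $x_i$ are degenerate. The degeneracy subset $\mathcal D(\sigma)$ is the set of $\sigma$-degenerate elements. $\Sigma^\chi_{g,n}$ is ordered by $\sigma_1\ge\sigma_2$ iff $\sigma_1(x)\ge\sigma_2(x)$ for all $x\in\mathbb D_{g,n}$. An element is submaximal if it has height one, i.e. it is not maximal and the only elements strictly greater than it are maximal. *)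

theory Defs
  imports Complex_Main "HOL-Library.Multiset" "HOL-Library.FuncSet"
begin

type_synonym triple = "int \<times> int \<times> nat set"

definition stable_domain :: "nat \<Rightarrow> nat \<Rightarrow> triple set" where
  "stable_domain g n = {(e, h, A).
     0 < e \<and> 0 \<le> h \<and> h \<le> int g - e + 1 \<and> A \<subseteq> {1..n} \<and>
     2 * h - 2 + e + int (card A) > 0 \<and>
     2 * int g - 2 * h - e + int (card ({1..n} - A)) > 0}"

fun compl :: "nat \<Rightarrow> nat \<Rightarrow> triple \<Rightarrow> triple" where
  "compl g n (e, h, A) = (e, int g - h - e + 1, {1..n} - A)"

text \<open>The defining conditions are invariant under permuting the three triples, so the
  choice of an enumeration of the multiset is immaterial.\<close>

definition triangles :: "nat \<Rightarrow> nat \<Rightarrow> triple multiset set" where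
  "triangles g n = {{#(e1, h1, A1), (e2, h2, A2), (e3, h3, A3)#} | e1 h1 A1 e2 h2 A2 e3 h3 A3.
     (e1, h1, A1) \<in> stable_domain g n \<and>
     (e2, h2, A2) \<in> stable_domain g n \<and>
     (e3, h3, A3) \<in> stable_domain g n \<and>
     even (e1 + e2 + e3) \<and>
     e1 + e2 \<ge> e3 + 2 \<and> e1 + e3 \<ge> e2 + 2 \<and> e2 + e3 \<ge> e1 + 2 \<and>
     A1 \<union> A2 \<union> A3 = {1..n} \<and> A1 \<inter> A2 = {} \<and> A1 \<inter> A3 = {} \<and> A2 \<inter> A3 = {} \<and>
     int g = h1 + h2 + h3 + (e1 + e2 + e3) div 2 - 2}"

definition degenerate :: "nat \<Rightarrow> nat \<Rightarrow> int \<Rightarrow> (triple \<Rightarrow> int) \<Rightarrow> triple \<Rightarrow> bool" where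
  "degenerate g n \<chi> \<sigma> x \<longleftrightarrow> \<sigma> x + \<sigma> (compl g n x) - \<chi> = 0"

definition num_degenerate :: "nat \<Rightarrow> nat \<Rightarrow> int \<Rightarrow> (triple \<Rightarrow> int) \<Rightarrow> triple multiset \<Rightarrow> nat" where
  "num_degenerate g n \<chi> \<sigma> T = size (filter_mset (degenerate g n \<chi> \<sigma>) T)"

definition triangle_excess :: "int \<Rightarrow> (triple \<Rightarrow> int) \<Rightarrow> triple multiset \<Rightarrow> int" where
  "triangle_excess \<chi> \<sigma> T = (\<Sum>x\<in>#T. \<sigma> x) - \<chi>"

text \<open>Functions with domain \<^term>\<open>stable_domain g n\<close> are represented by extensional functions,
  so that equality of V-functions is equality on the domain. Degenerate elements of a triangle
  are counted with multiplicity.\<close>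

definition V_functions :: "nat \<Rightarrow> nat \<Rightarrow> int \<Rightarrow> (triple \<Rightarrow> int) set" where
  "V_functions g n \<chi> = {\<sigma> \<in> extensional (stable_domain g n).
     (\<forall>x \<in> stable_domain g n. \<sigma> x + \<sigma> (compl g n x) - \<chi> \<in> {0, 1}) \<and>
     (\<forall>T \<in> triangles g n.
        (num_degenerate g n \<chi> \<sigma> T \<ge> 2 \<longrightarrow> num_degenerate g n \<chi> \<sigma> T = 3) \<and>
        (num_degenerate g n \<chi> \<sigma> T = 0 \<longrightarrow> triangle_excess \<chi> \<sigma> T \<in> {1, 2}) \<and>
        (num_degenerate g n \<chi> \<sigma> T = 1 \<longrightarrow> triangle_excess \<chi> \<sigma> T = 1) \<and>
        (num_degenerate g n \<chi> \<sigma> T = 3 \<longrightarrow> triangle_excess \<chi> \<sigma> T = 0))}"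

definition degeneracy :: "nat \<Rightarrow> nat \<Rightarrow> int \<Rightarrow> (triple \<Rightarrow> int) \<Rightarrow> triple set" where
  "degeneracy g n \<chi> \<sigma> = {x \<in> stable_domain g n. degenerate g n \<chi> \<sigma> x}"

definition V_le :: "nat \<Rightarrow> nat \<Rightarrow> (triple \<Rightarrow> int) \<Rightarrow> (triple \<Rightarrow> int) \<Rightarrow> bool" where
  "V_le g n \<sigma> \<tau> \<longleftrightarrow> (\<forall>x \<in> stable_domain g n. \<sigma> x \<le> \<tau> x)"

definition V_less :: "nat \<Rightarrow> nat \<Rightarrow> (triple \<Rightarrow> int) \<Rightarrow> (triple \<Rightarrow> int) \<Rightarrow> bool" where
  "V_less g n \<sigma> \<tau> \<longleftrightarrow> V_le g n \<sigma> \<tau> \<and> \<sigma> \<noteq> \<tau>"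

definition maximal_V :: "nat \<Rightarrow> nat \<Rightarrow> int \<Rightarrow> (triple \<Rightarrow> int) set" where
  "maximal_V g n \<chi> = {\<sigma> \<in> V_functions g n \<chi>. \<not> (\<exists>\<tau> \<in> V_functions g n \<chi>. V_less g n \<sigma> \<tau>)}"

definition submaximal_V :: "nat \<Rightarrow> nat \<Rightarrow> int \<Rightarrow> (triple \<Rightarrow> int) set" where
  "submaximal_V g n \<chi> = {\<sigma> \<in> V_functions g n \<chi>. \<sigma> \<notin> maximal_V g n \<chi> \<and>
     (\<forall>\<tau> \<in> V_functions g n \<chi>. V_less g n \<sigma> \<tau> \<longrightarrow> \<tau> \<in> maximal_V g n \<chi>)}"

definition pair_sets :: "nat \<Rightarrow> nat \<Rightarrow> triple set set" where
  "pair_sets g n = {{(e, h, A), compl g n (e, h, A)} | e h A.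
     (e, h, A) \<in> stable_domain g n \<and>
     (e = 1 \<or> ({} \<subset> A \<and> A \<subset> {1..n}) \<or>
      (A = {} \<and> 2 * h - 2 + e \<ge> int g) \<or>
      (A = {1..n} \<and> 2 * h + e \<le> int g))}"

definition W :: "nat \<Rightarrow> nat \<Rightarrow> int \<Rightarrow> triple set" where
  "W g n \<delta> = (\<Union>(e, h) \<in> {(e, h). (e, h, {}) \<in> stable_domain g n \<and> \<delta> dvd (2 * h - 2 + e) \<and> e \<ge> 2}.
     {(e, h, {}), compl g n (e, h, {})})"

end

theory Submission
  imports Defs "HOL-Library.Nat_Bijection"
begin

text \<open>
  Let \<open>\<sigma>\<close> be a V-function with degeneracy subset \<open>D\<close>. The sum of \<open>\<sigma>\<close> over a complementary pair is
  \<open>\<chi>\<close> or \<open>\<chi> + 1\<close>, so a V-function above \<open>\<sigma>\<close> agrees with it off \<open>D\<close>, and on each degenerate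
  pair it raises at most one element, by one. Recording this by a sign on \<open>D\<close>, antisymmetric
  under complements, the triangle axioms turn into the single condition that on every triangle inside
  \<open>D\<close> the signs are all zero or include both \<open>1\<close> and \<open>-1\<close>. Thus the V-functions above
  \<open>\<sigma>\<close> correspond to such sign patterns on \<open>D\<close> (\<open>lift_V\<close>, \<open>V_le_obtain_sign_pattern\<close>), and
  the degeneracy subset of a lift is the zero set of its pattern. The order near \<open>\<sigma>\<close> depends on \<open>D\<close>
  only: \<open>\<sigma>\<close> is maximal if \<open>D\<close> has no nonzero pattern, and submaximal if nonzero patterns exist
  but vanish nowhere.

  Everything then follows from finding sign patterns. A complementary pair that meets no triangle inside
  \<open>D\<close> can be resolved alone; this applies to elements with one edge, which lie in no triangle at all.
  If \<open>D\<close> contains a side with proper mark set \<open>A\<close>, then \<open>[i \<in> A] - [j \<in> A]\<close> is a pattern, and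
  demanding that these patterns have no zeros for all \<open>i\<close>, \<open>j\<close> separated by \<open>A\<close> leaves only
  sides with mark set \<open>A\<close> or its complement, which form no triangles. The last case is that all
  sides in \<open>D\<close> have at least two edges and are unmarked or complementary to unmarked ones. Let \<open>m\<close> be the least
  degree \<open>2h - 2 + e\<close> of an unmarked side in \<open>D\<close>. If \<open>m \<ge> g\<close>, there is no room for a triangle. If
  \<open>m < g\<close>, two copies of a side of degree \<open>m\<close> form a triangle with the complement of a side of
  degree \<open>2m\<close>, and the parity of the values of \<open>\<sigma>\<close> forces every unmarked side of degree \<open>m\<close> with at
  least two edges to be degenerate (\<open>V_equal_omega_degenerate\<close>); splitting sides into sides of
  smaller degree gives \<open>D = W_m\<close> (\<open>V_dvd_omega_degenerate\<close>, \<open>V_min_omega_dvd\<close>). On \<open>W_m\<close> the same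
  triangles show that a pattern is determined by one sign (\<open>sign_pattern_W_constant\<close>). So the sets of
  the theorem are rigid, with two nonzero patterns that are negatives of each other, and every other
  nonempty degeneracy subset has a nonzero pattern with a zero (\<open>degeneracy_submaximal_or_mixed\<close>).

  For existence, rounding up a rational additive function produces a V-function whose
  degenerate elements with at least two edges are those where the function is integral (\<open>rounded_V\<close>). Its coefficients are chosen such that the degenerate triangles
  all lie in the desired set, after which the superfluous degenerate pairs are resolved by a
  sign pattern (\<open>prune_degeneracy\<close>).
\<close>

section \<open>Additive coordinates on stable triples\<close>

text \<open>A triple \<open>(e, h, A)\<close> is one side of a vine curve: \<open>e\<close> nodes join it to the other side,
  \<open>h\<close> is its genus and \<open>A\<close> its set of marked points. Replacing \<open>h\<close> by the degree
  \<open>2h - 2 + e\<close> of the dualizing sheaf makes everything additive: complementary sides, and the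
  three sides of a triangle, have degrees adding up to \<open>2g - 2\<close>.\<close>

definition edges :: "triple \<Rightarrow> int" where "edges x = fst x"

definition marks :: "triple \<Rightarrow> nat set" where "marks x = snd (snd x)"

definition omega :: "triple \<Rightarrow> int" where "omega x = 2 * fst (snd x) - 2 + fst x"

text \<open>The inverse change of coordinates. It is meaningful only when \<open>d\<close> and \<open>e\<close> have the same
  parity.\<close>

definition with_omega :: "int \<Rightarrow> int \<Rightarrow> nat set \<Rightarrow> triple" where
  "with_omega e d A = (e, (d - e) div 2 + 1, A)"

definition is_triangle :: "nat \<Rightarrow> nat \<Rightarrow> triple \<Rightarrow> triple \<Rightarrow> triple \<Rightarrow> bool" where
  "is_triangle g n x y z \<longleftrightarrow>
     x \<in> stable_domain g n \<and> y \<in> stable_domain g n \<and> z \<in> stable_domain g n \<and>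
     even (edges x + edges y + edges z) \<and>
     edges x + edges y \<ge> edges z + 2 \<and> edges x + edges z \<ge> edges y + 2 \<and>
     edges y + edges z \<ge> edges x + 2 \<and>
     marks x \<union> marks y \<union> marks z = {1..n} \<and>
     marks x \<inter> marks y = {} \<and> marks x \<inter> marks z = {} \<and> marks y \<inter> marks z = {} \<and>
     omega x + omega y + omega z = 2 * int g - 2"

lemma with_omega_simps [simp]:
  "edges (with_omega e d A) = e" "marks (with_omega e d A) = A"
  "even (d - e) \<Longrightarrow> omega (with_omega e d A) = d"
  by (auto simp: with_omega_def edges_def marks_def omega_def)

lemma triple_simps [simp]:
  "edges (e, h, A) = e" "marks (e, h, A) = A" "omega (e, h, A) = 2 * h - 2 + e"
  by (auto simp: edges_def marks_def omega_def)

lemma triple_eqI: "edges x = edges y \<Longrightarrow> omega x = omega y \<Longrightarrow> marks x = marks y \<Longrightarrow> x = y"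
  by (cases x; cases y) auto

lemma even_omega_edges: "even (omega x - edges x)"
  by (cases x) auto

lemma stable_domain_iff:
  "x \<in> stable_domain g n \<longleftrightarrow> 1 \<le> edges x \<and> edges x - 2 \<le> omega x \<and> omega x \<le> 2 * int g - edges x \<and>
     marks x \<subseteq> {1..n} \<and> omega x + int (card (marks x)) > 0 \<and>
     2 * int g - 2 - omega x + int (card ({1..n} - marks x)) > 0"
  by (cases x) (auto simp: stable_domain_def)

lemma compl_simps [simp]:
  "edges (compl g n x) = edges x" "omega (compl g n x) = 2 * int g - 2 - omega x"
  "marks (compl g n x) = {1..n} - marks x"
  by (cases x; auto)+

lemma compl_in_domain: "x \<in> stable_domain g n \<Longrightarrow> compl g n x \<in> stable_domain g n"
  by (auto simp: stable_domain_iff double_diff)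

lemma compl_compl: "x \<in> stable_domain g n \<Longrightarrow> compl g n (compl g n x) = x"
  by (rule triple_eqI) (auto simp: stable_domain_iff double_diff)

lemma compl_neq: "n \<ge> 1 \<Longrightarrow> compl g n x \<noteq> x"
proof
  assume n: "n \<ge> 1" and "compl g n x = x"
  then have "{1..n} - marks x = marks x" using compl_simps(3) by metis
  moreover have "1 \<in> {1..n}" using n by simp
  ultimately show False by blast
qed

lemma one_mem_marks_compl:
  "n \<ge> 1 \<Longrightarrow> 1 \<in> marks (compl g n x) \<longleftrightarrow> 1 \<notin> marks x"
  by auto

text \<open>For an even number of edges, the genus formula of a triangle is the additivity of the degree
  of the dualizing sheaf.\<close>

lemma triangles_eq: "triangles g n = {{#x, y, z#} | x y z. is_triangle g n x y z}"
proof -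
  have *: "is_triangle g n (e1, h1, A1) (e2, h2, A2) (e3, h3, A3) \<longleftrightarrow>
     (e1, h1, A1) \<in> stable_domain g n \<and> (e2, h2, A2) \<in> stable_domain g n \<and>
     (e3, h3, A3) \<in> stable_domain g n \<and> even (e1 + e2 + e3) \<and>
     e1 + e2 \<ge> e3 + 2 \<and> e1 + e3 \<ge> e2 + 2 \<and> e2 + e3 \<ge> e1 + 2 \<and>
     A1 \<union> A2 \<union> A3 = {1..n} \<and> A1 \<inter> A2 = {} \<and> A1 \<inter> A3 = {} \<and> A2 \<inter> A3 = {} \<and>
     int g = h1 + h2 + h3 + (e1 + e2 + e3) div 2 - 2" for e1 h1 A1 e2 h2 A2 e3 h3 A3
  proof -
    have "even (e1 + e2 + e3) \<Longrightarrow> (2*h1-2+e1) + (2*h2-2+e2) + (2*h3-2+e3) = 2 * int g - 2 \<longleftrightarrow>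
       int g = h1 + h2 + h3 + (e1 + e2 + e3) div 2 - 2"
      by (elim evenE) auto
    then show ?thesis unfolding is_triangle_def triple_simps by blast
  qed
  show ?thesis
    unfolding triangles_def set_eq_iff mem_Collect_eq split_paired_Ex * by blast
qed

lemma triangle_swap:
  "is_triangle g n x y z \<Longrightarrow> is_triangle g n y x z" "is_triangle g n x y z \<Longrightarrow> is_triangle g n x z y"
  unfolding is_triangle_def by (auto simp: ac_simps)

text \<open>Adding two of the three triangle inequalities. Hence elements with a single edge impose no
  relations on a V-function beyond the one with their complement.\<close>

lemma triangle_edges_ge2: "is_triangle g n x y z \<Longrightarrow> edges x \<ge> 2 \<and> edges y \<ge> 2 \<and> edges z \<ge> 2"
  unfolding is_triangle_def by linarith

section \<open>V-functions and enumerated triangles\<close>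

text \<open>The condition on the excess \<open>k\<close> of a triangle whose elements have degeneracy flags
  \<open>p\<close>, \<open>q\<close>, \<open>r\<close>.\<close>

definition excess_rule :: "bool \<Rightarrow> bool \<Rightarrow> bool \<Rightarrow> int \<Rightarrow> bool" where
  "excess_rule p q r k \<longleftrightarrow>
     (p \<and> q \<longrightarrow> r) \<and> (p \<and> r \<longrightarrow> q) \<and> (q \<and> r \<longrightarrow> p) \<and>
     k \<in> (if p \<and> q \<and> r then {0} else if p \<or> q \<or> r then {1} else {1, 2})"

lemma V_functions_iff:
  "\<sigma> \<in> V_functions g n \<chi> \<longleftrightarrow> \<sigma> \<in> extensional (stable_domain g n) \<and>
     (\<forall>x \<in> stable_domain g n. \<sigma> x + \<sigma> (compl g n x) - \<chi> \<in> {0, 1}) \<and>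
     (\<forall>x y z. is_triangle g n x y z \<longrightarrow>
        excess_rule (degenerate g n \<chi> \<sigma> x) (degenerate g n \<chi> \<sigma> y) (degenerate g n \<chi> \<sigma> z)
          (\<sigma> x + \<sigma> y + \<sigma> z - \<chi>))"
proof -
  define Q where "Q T \<longleftrightarrow> (num_degenerate g n \<chi> \<sigma> T \<ge> 2 \<longrightarrow> num_degenerate g n \<chi> \<sigma> T = 3) \<and>
        (num_degenerate g n \<chi> \<sigma> T = 0 \<longrightarrow> triangle_excess \<chi> \<sigma> T \<in> {1, 2}) \<and>
        (num_degenerate g n \<chi> \<sigma> T = 1 \<longrightarrow> triangle_excess \<chi> \<sigma> T = 1) \<and>
        (num_degenerate g n \<chi> \<sigma> T = 3 \<longrightarrow> triangle_excess \<chi> \<sigma> T = 0)" for T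
  have "Q {#x, y, z#} \<longleftrightarrow>
     excess_rule (degenerate g n \<chi> \<sigma> x) (degenerate g n \<chi> \<sigma> y) (degenerate g n \<chi> \<sigma> z)
          (\<sigma> x + \<sigma> y + \<sigma> z - \<chi>)" for x y z
    unfolding Q_def num_degenerate_def triangle_excess_def excess_rule_def
    by (cases "degenerate g n \<chi> \<sigma> x"; cases "degenerate g n \<chi> \<sigma> y"; cases "degenerate g n \<chi> \<sigma> z")
       (simp_all add: add.assoc)
  then have "(\<forall>T \<in> triangles g n. Q T) \<longleftrightarrow> (\<forall>x y z. is_triangle g n x y z \<longrightarrow>
        excess_rule (degenerate g n \<chi> \<sigma> x) (degenerate g n \<chi> \<sigma> y) (degenerate g n \<chi> \<sigma> z)
          (\<sigma> x + \<sigma> y + \<sigma> z - \<chi>))"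
    unfolding triangles_eq Ball_def mem_Collect_eq by blast
  then show ?thesis unfolding V_functions_def Q_def by simp
qed

lemma degenerate_compl:
  "x \<in> stable_domain g n \<Longrightarrow> degenerate g n \<chi> \<sigma> (compl g n x) \<longleftrightarrow> degenerate g n \<chi> \<sigma> x"
  by (auto simp: degenerate_def compl_compl)

lemma degeneracy_subset: "degeneracy g n \<chi> \<sigma> \<subseteq> stable_domain g n"
  by (auto simp: degeneracy_def)

lemma compl_mem_degeneracy_iff:
  "x \<in> stable_domain g n \<Longrightarrow> compl g n x \<in> degeneracy g n \<chi> \<sigma> \<longleftrightarrow> x \<in> degeneracy g n \<chi> \<sigma>"
  by (simp add: degeneracy_def degenerate_compl compl_in_domain)

lemma V_triangle:
  assumes "\<sigma> \<in> V_functions g n \<chi>" "is_triangle g n x y z"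
  shows "excess_rule (x \<in> degeneracy g n \<chi> \<sigma>) (y \<in> degeneracy g n \<chi> \<sigma>)
    (z \<in> degeneracy g n \<chi> \<sigma>) (\<sigma> x + \<sigma> y + \<sigma> z - \<chi>)"
proof -
  have "x \<in> stable_domain g n" "y \<in> stable_domain g n" "z \<in> stable_domain g n"
    using assms(2) by (simp_all add: is_triangle_def)
  moreover have "excess_rule (degenerate g n \<chi> \<sigma> x) (degenerate g n \<chi> \<sigma> y)
      (degenerate g n \<chi> \<sigma> z) (\<sigma> x + \<sigma> y + \<sigma> z - \<chi>)"
    using assms(1)[unfolded V_functions_iff, THEN conjunct2, THEN conjunct2, rule_format, OF assms(2)] .
  ultimately show ?thesis by (simp add: degeneracy_def)
qed

lemma degeneracy_triangle:
  assumes "\<sigma> \<in> V_functions g n \<chi>" "is_triangle g n x y z"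
    "x \<in> degeneracy g n \<chi> \<sigma>" "y \<in> degeneracy g n \<chi> \<sigma>"
  shows "z \<in> degeneracy g n \<chi> \<sigma>"
  using V_triangle[OF assms(1,2)] assms(3,4) unfolding excess_rule_def by blast

section \<open>Sign patterns describe the V-functions above a given one\<close>

text \<open>Three signs that can occur on a triple of numbers with sum zero.\<close>

definition balanced :: "int \<Rightarrow> int \<Rightarrow> int \<Rightarrow> bool" where
  "balanced a b c \<longleftrightarrow> {a, b, c} = {0} \<or> {-1, 1} \<subseteq> {a, b, c}"

text \<open>The combinatorial shadow of a real-valued additive function on \<open>D\<close>: on a degeneracy subset
  it records into which of the two possible directions each degenerate pair is resolved, with
  \<open>0\<close> for a pair that is left degenerate.\<close>

definition sign_pattern :: "nat \<Rightarrow> nat \<Rightarrow> triple set \<Rightarrow> (triple \<Rightarrow> int) \<Rightarrow> bool" where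
  "sign_pattern g n D s \<longleftrightarrow>
     (\<forall>x\<in>D. s x \<in> {-1, 0, 1} \<and> s (compl g n x) = - s x) \<and>
     (\<forall>x\<in>D. \<forall>y\<in>D. \<forall>z\<in>D. is_triangle g n x y z \<longrightarrow> balanced (s x) (s y) (s z))"

lemma sign_patternI:
  assumes "\<And>x. x \<in> D \<Longrightarrow> s x \<in> {-1, 0, 1}" "\<And>x. x \<in> D \<Longrightarrow> s (compl g n x) = - s x"
    "\<And>x y z. x \<in> D \<Longrightarrow> y \<in> D \<Longrightarrow> z \<in> D \<Longrightarrow> is_triangle g n x y z \<Longrightarrow> balanced (s x) (s y) (s z)"
  shows "sign_pattern g n D s"
  using assms unfolding sign_pattern_def by blast

lemma sign_patternD:
  assumes "sign_pattern g n D s" "x \<in> D"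
  shows "s x \<in> {-1, 0, 1}" "s (compl g n x) = - s x"
    "y \<in> D \<Longrightarrow> z \<in> D \<Longrightarrow> is_triangle g n x y z \<Longrightarrow> balanced (s x) (s y) (s z)"
  using assms unfolding sign_pattern_def by blast+

lemma balanced_uminus: "balanced a b c \<Longrightarrow> balanced (- a) (- b) (- c)"
  unfolding balanced_def by auto

lemma sign_pattern_uminus: "sign_pattern g n D s \<Longrightarrow> sign_pattern g n D (\<lambda>x. - s x)"
  unfolding sign_pattern_def by (auto simp: balanced_uminus)

text \<open>Of a complementary pair that is resolved, exactly one element is raised, and by \<open>1\<close>: the sum
  over the pair has to grow from \<open>\<chi>\<close> to \<open>\<chi> + 1\<close>.\<close>

definition lift :: "nat \<Rightarrow> nat \<Rightarrow> int \<Rightarrow> (triple \<Rightarrow> int) \<Rightarrow> (triple \<Rightarrow> int) \<Rightarrow> triple \<Rightarrow> int" where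
  "lift g n \<chi> \<sigma> s x = \<sigma> x + of_bool (x \<in> degeneracy g n \<chi> \<sigma> \<and> s x = 1)"

lemma V_pair_sum:
  assumes "\<sigma> \<in> V_functions g n \<chi>" "x \<in> stable_domain g n"
  shows "\<sigma> x + \<sigma> (compl g n x) = \<chi> + of_bool (x \<notin> degeneracy g n \<chi> \<sigma>)"
  using assms by (auto simp: V_functions_iff degeneracy_def degenerate_def)

lemma V_undefined: "\<sigma> \<in> V_functions g n \<chi> \<Longrightarrow> x \<notin> stable_domain g n \<Longrightarrow> \<sigma> x = undefined"
  unfolding V_functions_iff by (blast intro: extensional_arb)

lemma lift_degenerate_iff:
  assumes "\<sigma> \<in> V_functions g n \<chi>" "sign_pattern g n (degeneracy g n \<chi> \<sigma>) s" "x \<in> stable_domain g n"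
  shows "lift g n \<chi> \<sigma> s x + lift g n \<chi> \<sigma> s (compl g n x) =
      \<chi> + of_bool (x \<notin> degeneracy g n \<chi> \<sigma> \<or> s x \<noteq> 0)"
proof (cases "x \<in> degeneracy g n \<chi> \<sigma>")
  case True
  then show ?thesis
    using sign_patternD(1,2)[OF assms(2) True] V_pair_sum[OF assms(1,3)] assms(3)
    by (auto simp: lift_def compl_mem_degeneracy_iff)
next
  case False
  then show ?thesis using V_pair_sum[OF assms(1,3)] assms(3)
    by (auto simp: lift_def compl_mem_degeneracy_iff)
qed

text \<open>On a fully degenerate triangle the old excess is \<open>0\<close>, so the new one counts the positive
  signs. Requiring this count to be \<open>1\<close> or \<open>2\<close> when no sign vanishes, and \<open>1\<close> when exactly one
  vanishes, says that both signs occur.\<close>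

lemma excess_rule_signs_iff_balanced:
  assumes "a \<in> {-1, 0, 1}" "b \<in> {-1, 0, 1}" "c \<in> {-1, 0, 1}"
  shows "excess_rule (a = 0) (b = 0) (c = 0) (of_bool (a = 1) + of_bool (b = 1) + of_bool (c = 1))
    \<longleftrightarrow> balanced a b c"
  using assms by (elim insertE emptyE) (simp_all add: excess_rule_def balanced_def)

text \<open>A triangle that is not fully degenerate has at most one degenerate element. If it has one, the
  excess is \<open>1\<close> and may stay or grow to \<open>2\<close> when that element is resolved, so no condition arises.\<close>

lemma excess_rule_lift:
  assumes "excess_rule p q r k"
    and "\<lbrakk>p; q; r\<rbrakk> \<Longrightarrow> balanced a b c" "\<lbrakk>p; q; r\<rbrakk> \<Longrightarrow> a \<in> {-1, 0, 1}"
    "\<lbrakk>p; q; r\<rbrakk> \<Longrightarrow> b \<in> {-1, 0, 1}" "\<lbrakk>p; q; r\<rbrakk> \<Longrightarrow> c \<in> {-1, 0, 1}"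
  shows "excess_rule (p \<and> a = 0) (q \<and> b = 0) (r \<and> c = 0)
     (k + of_bool (p \<and> a = 1) + of_bool (q \<and> b = 1) + of_bool (r \<and> c = 1))"
proof (cases "p \<and> q \<and> r")
  case True
  then have "k = 0" using assms(1) by (simp add: excess_rule_def)
  with True assms(2-) show ?thesis
    using excess_rule_signs_iff_balanced[of a b c] by simp
next
  case False
  then show ?thesis using assms(1) by (cases p; cases q; cases r) (simp_all add: excess_rule_def)
qed

lemma lift_V:
  assumes V: "\<sigma> \<in> V_functions g n \<chi>" and s: "sign_pattern g n (degeneracy g n \<chi> \<sigma>) s"
  shows "lift g n \<chi> \<sigma> s \<in> V_functions g n \<chi>"
    and "degeneracy g n \<chi> (lift g n \<chi> \<sigma> s) = {x \<in> degeneracy g n \<chi> \<sigma>. s x = 0}"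
    and "V_le g n \<sigma> (lift g n \<chi> \<sigma> s)"
proof -
  let ?D = "degeneracy g n \<chi> \<sigma>" and ?\<tau> = "lift g n \<chi> \<sigma> s"
  have deg: "degenerate g n \<chi> ?\<tau> x \<longleftrightarrow> x \<in> ?D \<and> s x = 0" if "x \<in> stable_domain g n" for x
    using lift_degenerate_iff[OF V s that] by (auto simp: degenerate_def)
  show "degeneracy g n \<chi> ?\<tau> = {x \<in> ?D. s x = 0}"
    using deg degeneracy_subset by (auto simp: degeneracy_def)
  show "V_le g n \<sigma> ?\<tau>" by (auto simp: V_le_def lift_def)
  have ext: "?\<tau> \<in> extensional (stable_domain g n)"
    using V degeneracy_subset[of g n \<chi> \<sigma>] by (auto simp: extensional_def V_functions_iff lift_def)
  have sum: "?\<tau> x + ?\<tau> (compl g n x) - \<chi> \<in> {0, 1}" if "x \<in> stable_domain g n" for x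
    using lift_degenerate_iff[OF V s that] by auto
  have "excess_rule (degenerate g n \<chi> ?\<tau> x) (degenerate g n \<chi> ?\<tau> y) (degenerate g n \<chi> ?\<tau> z)
          (?\<tau> x + ?\<tau> y + ?\<tau> z - \<chi>)" if T: "is_triangle g n x y z" for x y z
  proof -
    have dom: "x \<in> stable_domain g n" "y \<in> stable_domain g n" "z \<in> stable_domain g n"
      using T by (auto simp: is_triangle_def)
    have rule: "excess_rule (x \<in> ?D) (y \<in> ?D) (z \<in> ?D) (\<sigma> x + \<sigma> y + \<sigma> z - \<chi>)"
      by (rule V_triangle[OF V T])
    have "balanced (s x) (s y) (s z)" "s x \<in> {-1,0,1}" "s y \<in> {-1,0,1}" "s z \<in> {-1,0,1}"
      if "x \<in> ?D" "y \<in> ?D" "z \<in> ?D"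
      using sign_patternD[OF s] T that by blast+
    from excess_rule_lift[OF rule this] show ?thesis
      by (simp add: deg[OF dom(1)] deg[OF dom(2)] deg[OF dom(3)] lift_def algebra_simps)
  qed
  with ext sum show "?\<tau> \<in> V_functions g n \<chi>" by (simp add: V_functions_iff)
qed

text \<open>Conversely, every V-function above \<open>\<sigma>\<close> is a lift. The sum over a complementary pair can grow
  by at most \<open>1\<close>, and only if the pair is degenerate; the sign says which of the two elements
  has grown.\<close>

lemma V_le_obtain_sign_pattern:
  assumes V: "\<sigma> \<in> V_functions g n \<chi>" "\<tau> \<in> V_functions g n \<chi>" and le: "V_le g n \<sigma> \<tau>"
  obtains s where "sign_pattern g n (degeneracy g n \<chi> \<sigma>) s" "\<tau> = lift g n \<chi> \<sigma> s"
proof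
  let ?D = "degeneracy g n \<chi> \<sigma>"
  define s where "s x = (\<tau> x - \<sigma> x) - (\<tau> (compl g n x) - \<sigma> (compl g n x))" for x
  have le: "\<sigma> x \<le> \<tau> x" "\<sigma> (compl g n x) \<le> \<tau> (compl g n x)" if "x \<in> stable_domain g n" for x
    using le that compl_in_domain by (auto simp: V_le_def)
  note sums = V_pair_sum[OF V(1)] V_pair_sum[OF V(2)]
  have off: "\<tau> x = \<sigma> x \<and> x \<notin> degeneracy g n \<chi> \<tau>" if "x \<in> stable_domain g n" "x \<notin> ?D" for x
    using le[OF that(1)] sums[OF that(1)] that(2) by (cases "x \<in> degeneracy g n \<chi> \<tau>") auto
  have on: "\<tau> x = \<sigma> x + of_bool (s x = 1) \<and> s x \<in> {-1,0,1} \<and> s (compl g n x) = - s x \<and>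
      (x \<in> degeneracy g n \<chi> \<tau> \<longleftrightarrow> s x = 0)" if "x \<in> ?D" for x
  proof -
    have x: "x \<in> stable_domain g n" using that degeneracy_subset by blast
    define a b where "a = \<tau> x - \<sigma> x" and "b = \<tau> (compl g n x) - \<sigma> (compl g n x)"
    have s: "s x = a - b" "s (compl g n x) = b - a" "\<tau> x = \<sigma> x + a"
      by (simp_all add: s_def a_def b_def compl_compl[OF x])
    have "a \<ge> 0" "b \<ge> 0" "a + b = of_bool (x \<notin> degeneracy g n \<chi> \<tau>)"
      using le[OF x] sums[OF x] that by (simp_all add: a_def b_def)
    then consider "a = 0" "b = 0" "x \<in> degeneracy g n \<chi> \<tau>"
      | "a = 1" "b = 0" "x \<notin> degeneracy g n \<chi> \<tau>" | "a = 0" "b = 1" "x \<notin> degeneracy g n \<chi> \<tau>"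
      by (cases "x \<in> degeneracy g n \<chi> \<tau>") force+
    then show ?thesis unfolding s by cases simp_all
  qed
  show "\<tau> = lift g n \<chi> \<sigma> s"
  proof
    fix x
    show "\<tau> x = lift g n \<chi> \<sigma> s x"
    proof (cases "x \<in> stable_domain g n")
      case True then show ?thesis using on[of x] off[of x] by (cases "x \<in> ?D") (simp_all add: lift_def)
    next
      case False
      then show ?thesis using V_undefined[OF V(1)] V_undefined[OF V(2)] degeneracy_subset[of g n \<chi> \<sigma>]
        by (auto simp: lift_def)
    qed
  qed
  show "sign_pattern g n ?D s"
  proof (rule sign_patternI)
    fix x y z assume D: "x \<in> ?D" "y \<in> ?D" "z \<in> ?D" and T: "is_triangle g n x y z"
    have dom: "x \<in> stable_domain g n" "y \<in> stable_domain g n" "z \<in> stable_domain g n"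
      using T by (auto simp: is_triangle_def)
    have "\<sigma> x + \<sigma> y + \<sigma> z - \<chi> = 0"
      using V_triangle[OF V(1) T] D by (simp add: excess_rule_def)
    then have eq: "\<tau> x + \<tau> y + \<tau> z - \<chi> = of_bool (s x = 1) + of_bool (s y = 1) + of_bool (s z = 1)"
      using on[OF D(1)] on[OF D(2)] on[OF D(3)] by linarith
    show "balanced (s x) (s y) (s z)"
      using V_triangle[OF V(2) T, unfolded eq] on[OF D(1)] on[OF D(2)] on[OF D(3)]
        excess_rule_signs_iff_balanced[of "s x" "s y" "s z"] by simp
  qed (use on in blast)+
qed

lemma V_above_general_eq:
  assumes V: "\<sigma> \<in> V_functions g n \<chi>" "\<tau> \<in> V_functions g n \<chi>" and le: "V_le g n \<sigma> \<tau>"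
    and "degeneracy g n \<chi> \<sigma> = {}"
  shows "\<tau> = \<sigma>"
proof -
  obtain s where "\<tau> = lift g n \<chi> \<sigma> s" using V_le_obtain_sign_pattern[OF V le] by blast
  with assms(4) show ?thesis by (auto simp: lift_def)
qed

section \<open>Triangles of unmarked sides\<close>

lemma omega_pos: "x \<in> stable_domain g n \<Longrightarrow> marks x = {} \<Longrightarrow> omega x \<ge> 1"
  by (auto simp: stable_domain_iff)

lemma triangle_empty_full:
  assumes "n \<ge> 1" "is_triangle g n x y z"
    and "marks x \<in> {{}, {1..n}}" "marks y \<in> {{}, {1..n}}" "marks z \<in> {{}, {1..n}}"
  obtains "marks x = {}" "marks y = {}" "marks z = {1..n}"
    | "marks x = {}" "marks y = {1..n}" "marks z = {}"
    | "marks x = {1..n}" "marks y = {}" "marks z = {}"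
proof -
  have "{1..n} \<noteq> {}" using assms(1) by simp
  moreover have "marks x \<union> marks y \<union> marks z = {1..n}" "marks x \<inter> marks y = {}"
    "marks x \<inter> marks z = {}" "marks y \<inter> marks z = {}"
    using assms(2) by (simp_all add: is_triangle_def)
  ultimately show thesis using assms(3-) that by (elim insertE emptyE) simp_all
qed

text \<open>Two of the three sets would coincide and be disjoint, hence be empty.\<close>

lemma no_triangle_two_blocks:
  assumes "is_triangle g n x y z" "A \<subseteq> {1..n}" "A \<noteq> {}" "A \<noteq> {1..n}"
    and "marks x \<in> {A, {1..n} - A}" "marks y \<in> {A, {1..n} - A}" "marks z \<in> {A, {1..n} - A}"
  shows False
proof -
  have "marks x \<inter> marks y = {}" "marks x \<inter> marks z = {}" "marks y \<inter> marks z = {}"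
    using assms(1) by (simp_all add: is_triangle_def)
  moreover have "{1..n} - A \<noteq> {}" using assms(2,4) by blast
  ultimately show False using assms(3,5-) by (elim insertE emptyE) simp_all
qed

text \<open>The marks leave only triangles of the form \<open>u\<close>, \<open>u\<close>, \<open>u\<close>-complement with \<open>u\<close> unmarked. Then
  the degrees force \<open>omega u = 0\<close>, which stability excludes for an unmarked side.\<close>

lemma no_triangle_in_pair:
  assumes n: "n \<ge> 1" and x: "x \<in> stable_domain g n"
    and mem: "a \<in> {x, compl g n x}" "b \<in> {x, compl g n x}" "c \<in> {x, compl g n x}"
  shows "\<not> is_triangle g n a b c"
proof
  assume T: "is_triangle g n a b c"
  have sub: "marks x \<subseteq> {1..n}" using x by (simp add: stable_domain_iff)
  have "marks x \<in> {{}, {1..n}}"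
    using no_triangle_two_blocks[OF T sub] mem by force
  then have "\<exists>u. u \<in> stable_domain g n \<and> marks u = {} \<and> {x, compl g n x} = {u, compl g n u}"
  proof (elim insertE emptyE)
    assume "marks x = {1..n}"
    then show ?thesis using compl_in_domain[OF x] compl_compl[OF x]
      by (intro exI[of _ "compl g n x"]) auto
  qed (use x in blast)
  then obtain u where
    1: "u \<in> stable_domain g n" "marks u = {}" "{x, compl g n x} = {u, compl g n u}" by blast
  show False
  proof -
    have "{1..n} \<noteq> {}" using n by simp
    have w: "omega u \<ge> 1" by (rule omega_pos[OF 1(1,2)])
    have m: "(marks v = {} \<longrightarrow> omega v = omega u) \<and>
        (marks v = {1..n} \<longrightarrow> omega v = 2 * int g - 2 - omega u) \<and> marks v \<in> {{}, {1..n}}"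
      if "v \<in> {x, compl g n x}" for v
    proof -
      have "v = u \<or> v = compl g n u" using that 1(3) by blast
      then show ?thesis using 1(2) \<open>{1..n} \<noteq> {}\<close> by auto
    qed
    have sum: "omega a + omega b + omega c = 2 * int g - 2" using T by (simp add: is_triangle_def)
    show False
      by (rule triangle_empty_full[OF n T])
        (use m[OF mem(1)] m[OF mem(2)] m[OF mem(3)] w sum in linarith)+
  qed
qed

text \<open>Two copies of an unmarked side of degree \<open>d\<close> make up a side of degree \<open>2d\<close> with two edges. This
  triangle with a repeated element is the source of the parity arguments below.\<close>

lemma doubling_triangle:
  assumes n: "n \<ge> 1" and x: "x \<in> stable_domain g n" "marks x = {}" "edges x \<ge> 2"
    and le: "omega x \<le> int g - 1"
  shows "with_omega 2 (2 * omega x) {} \<in> stable_domain g n"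
    "is_triangle g n x x (compl g n (with_omega 2 (2 * omega x) {}))"
proof -
  let ?u = "with_omega 2 (2 * omega x) {}"
  have w: "omega x \<ge> 1" using omega_pos x by blast
  show u: "?u \<in> stable_domain g n"
    using n le w by (simp add: stable_domain_iff)
  show "is_triangle g n x x (compl g n ?u)"
    using compl_in_domain[OF u] x by (simp add: is_triangle_def)
qed

text \<open>An unmarked side of degree \<open>d1 + d2\<close> with at least two edges is the union of unmarked sides of
  degrees \<open>d1\<close> and \<open>d2\<close>. With \<open>t\<close> the number of edges minus two, sides of a triangle have
  values \<open>t\<close>, \<open>t1\<close>, \<open>t2\<close> subject to the ordinary triangle inequalities, and an unmarked side
  of degree \<open>d\<close> exists for \<open>0 \<le> t \<le> min d (2g - 2 - d)\<close> with \<open>t\<close> and \<open>d\<close> of equal parity.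
  So the first part receives as many edges as are needed and fit, and the second the smallest
  value permitted by parity or what exceeds the capacity of the first.\<close>

lemma splitting_triangle:
  assumes n: "n \<ge> 1" and x: "x \<in> stable_domain g n" "marks x = {}" "edges x \<ge> 2"
    and d: "omega x = d1 + d2" "d1 \<ge> 1" "d2 \<ge> 1"
  obtains y z where "is_triangle g n y z (compl g n x)" "marks y = {}" "marks z = {}"
    "omega y = d1" "omega z = d2"
proof -
  define t where "t = edges x - 2"
  have t: "0 \<le> t" "t \<le> d1 + d2" "t \<le> 2 * int g - 2 - (d1 + d2)" "even (d1 + d2 - t)"
    using x d(1) even_omega_edges[of x] by (auto simp: t_def stable_domain_iff)
  obtain t1 t2 where
    t12: "0 \<le> t1" "t1 \<le> d1" "t1 \<le> 2 * int g - 2 - d1" "even (d1 - t1)"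
       "0 \<le> t2" "t2 \<le> d2" "t2 \<le> 2 * int g - 2 - d2" "even (d2 - t2)"
       "t \<le> t1 + t2" "t1 \<le> t + t2" "t2 \<le> t + t1"
  proof (cases "t \<le> d1")
    case True
    consider "even d2" | "odd d2" "t \<ge> 1" | "odd d2" "t = 0" using t(1) by linarith
    then show ?thesis
    proof cases
      case 1
      show ?thesis by (rule that[of t 0]) (use True t d 1 in auto)
    next
      case 2
      show ?thesis by (rule that[of "t - 1" 1]) (use True t d 2 in auto)
    next
      case 3
      then have "odd d1" using t by simp
      with 3 show ?thesis by (intro that[of 1 1]) (use t d in auto)
    qed
  next
    case False
    show ?thesis by (rule that[of d1 "t - d1"]) (use False t d in auto)
  qed
  let ?y = "with_omega (t1 + 2) d1 {}" and ?z = "with_omega (t2 + 2) d2 {}"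
  have ev: "even (d1 - (t1 + 2))" "even (d2 - (t2 + 2))" using t12 by simp_all
  have dom: "?y \<in> stable_domain g n" "?z \<in> stable_domain g n"
    using n t12 d t ev by (simp_all add: stable_domain_iff)
  have "is_triangle g n ?y ?z (compl g n x)"
    using dom compl_in_domain[OF x(1)] t12 t d ev x(2) by (simp add: is_triangle_def t_def)
  then show thesis by (rule that) (use ev in simp_all)
qed

section \<open>Rigidity of pairs and of arithmetic progressions of degrees\<close>

text \<open>\<open>W g n \<delta>\<close> consists of the unmarked sides with at least two edges whose degree is a multiple of
  \<open>\<delta>\<close>, together with their complements.\<close>

lemma mem_W_iff:
  "x \<in> W g n \<delta> \<longleftrightarrow> (\<exists>y \<in> stable_domain g n. marks y = {} \<and> \<delta> dvd omega y \<and> edges y \<ge> 2 \<and>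
     (x = y \<or> x = compl g n y))"
proof
  assume "x \<in> W g n \<delta>"
  then obtain e h where "(e, h, {}) \<in> stable_domain g n" "\<delta> dvd (2 * h - 2 + e)" "e \<ge> 2"
    "x = (e, h, {}) \<or> x = compl g n (e, h, {})"
    unfolding W_def by auto
  then show "\<exists>y \<in> stable_domain g n. marks y = {} \<and> \<delta> dvd omega y \<and> edges y \<ge> 2 \<and>
     (x = y \<or> x = compl g n y)"
    by (intro bexI[of _ "(e, h, {})"]) simp_all
next
  assume "\<exists>y \<in> stable_domain g n. marks y = {} \<and> \<delta> dvd omega y \<and> edges y \<ge> 2 \<and>
     (x = y \<or> x = compl g n y)"
  then obtain y where y: "y \<in> stable_domain g n" "marks y = {}" "\<delta> dvd omega y" "edges y \<ge> 2"
     "x = y \<or> x = compl g n y" by blast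
  obtain e h A where "y = (e, h, A)" by (cases y)
  with y show "x \<in> W g n \<delta>" unfolding W_def by fastforce
qed

lemma mem_WI:
  "y \<in> stable_domain g n \<Longrightarrow> marks y = {} \<Longrightarrow> \<delta> dvd omega y \<Longrightarrow> edges y \<ge> 2 \<Longrightarrow> y \<in> W g n \<delta>"
  "y \<in> stable_domain g n \<Longrightarrow> marks y = {} \<Longrightarrow> \<delta> dvd omega y \<Longrightarrow> edges y \<ge> 2 \<Longrightarrow> compl g n y \<in> W g n \<delta>"
  unfolding mem_W_iff by blast+

lemma W_subset: "W g n \<delta> \<subseteq> stable_domain g n"
  unfolding mem_W_iff subset_iff using compl_in_domain by blast

lemma W_marks: "x \<in> W g n \<delta> \<Longrightarrow> marks x \<in> {{}, {1..n}}"
  unfolding mem_W_iff by auto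

text \<open>A triangle of such elements has exactly one element carrying all the marks.\<close>

lemma empty_full_sign_pattern:
  assumes n: "n \<ge> 1" and D: "\<And>x. x \<in> D \<Longrightarrow> marks x \<in> {{}, {1..n}}"
  shows "sign_pattern g n D (\<lambda>x. if marks x = {} then 1 else -1)"
proof (rule sign_patternI)
  have ne: "{1..n} \<noteq> {}" using n by simp
  show "(if marks (compl g n x) = {} then 1 else - 1 :: int) = - (if marks x = {} then 1 else - 1)"
    if "x \<in> D" for x using D[OF that] ne by auto
  show "balanced (if marks x = {} then 1 else - 1) (if marks y = {} then 1 else - 1)
      (if marks z = {} then 1 else - 1)"
    if "x \<in> D" "y \<in> D" "z \<in> D" "is_triangle g n x y z" for x y z
    using ne by (rule_tac triangle_empty_full[OF n that(4) D[OF that(1)] D[OF that(2)] D[OF that(3)]])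
      (simp_all add: balanced_def)
qed simp

text \<open>Up to a global sign there is only one nonzero sign pattern, and it vanishes nowhere. For a
  degeneracy subset this means that above \<open>\<sigma>\<close> there are exactly two V-functions, both general.\<close>

definition rigid :: "nat \<Rightarrow> nat \<Rightarrow> triple set \<Rightarrow> bool" where
  "rigid g n D \<longleftrightarrow> (\<exists>s. sign_pattern g n D s \<and> (\<forall>x\<in>D. s x \<noteq> 0) \<and>
     (\<forall>t. sign_pattern g n D t \<longrightarrow>
        (\<forall>x\<in>D. t x = 0) \<or> (\<forall>x\<in>D. t x = s x) \<or> (\<forall>x\<in>D. t x = - s x)))"

lemma rigid_pair:
  assumes n: "n \<ge> 1" and x: "x \<in> stable_domain g n"
  shows "rigid g n {x, compl g n x}"
proof -
  have ne: "compl g n x \<noteq> x" by (rule compl_neq[OF n])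
  let ?s = "\<lambda>y. if y = x then 1 else (-1 :: int)"
  have "sign_pattern g n {x, compl g n x} ?s"
  proof (rule sign_patternI)
    show "?s (compl g n y) = - ?s y" if "y \<in> {x, compl g n x}" for y
      using that ne compl_compl[OF x] by auto
    show "balanced (?s a) (?s b) (?s c)"
      if "a \<in> {x, compl g n x}" "b \<in> {x, compl g n x}" "c \<in> {x, compl g n x}"
        "is_triangle g n a b c" for a b c
      using no_triangle_in_pair[OF n x that(1-3)] that(4) by contradiction
  qed simp
  moreover have "(\<forall>y\<in>{x, compl g n x}. t y = 0) \<or> (\<forall>y\<in>{x, compl g n x}. t y = ?s y) \<or>
      (\<forall>y\<in>{x, compl g n x}. t y = - ?s y)" if "sign_pattern g n {x, compl g n x} t" for t
    using sign_patternD(1,2)[OF that, of x] ne by simp blast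
  moreover have "\<forall>y\<in>{x, compl g n x}. ?s y \<noteq> 0" by simp
  ultimately show ?thesis unfolding rigid_def by blast
qed

lemma balanced_double: "balanced a a (- b) \<Longrightarrow> a \<in> {-1, 0, 1} \<Longrightarrow> b \<in> {-1, 0, 1} \<Longrightarrow> a = b"
  by (elim insertE emptyE) (simp_all add: balanced_def)

text \<open>The doubling triangle of an element of degree \<open>\<delta>\<close> forces its sign to agree with that of the
  element of degree \<open>2\<delta>\<close> with two edges, which serves as common reference. Splitting off a part
  of degree \<open>\<delta>\<close> then propagates the sign to all multiples of \<open>\<delta>\<close>.\<close>

lemma sign_pattern_W_constant:
  assumes n: "n \<ge> 1" and \<delta>: "1 \<le> \<delta>" "\<delta> \<le> int g - 1" and s: "sign_pattern g n (W g n \<delta>) s"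
    and "x \<in> stable_domain g n" "marks x = {}" "edges x \<ge> 2" "\<delta> dvd omega x"
  shows "s x = s (with_omega 2 (2 * \<delta>) {})"
  using assms(5-)
proof (induction "nat (omega x)" arbitrary: x rule: less_induct)
  case less
  note x = less.prems
  let ?u = "with_omega 2 (2 * \<delta>) {}"
  have u: "?u \<in> W g n \<delta>" using \<delta> n by (intro mem_WI) (simp_all add: stable_domain_iff)
  have xW: "x \<in> W g n \<delta>" "compl g n x \<in> W g n \<delta>" using x by (simp_all add: mem_WI)
  note vals = sign_patternD(1)[OF s] and cmp = sign_patternD(2)[OF s]
  show ?case
  proof (cases "omega x = \<delta>")
    case True
    then have uD: "?u \<in> stable_domain g n" and T: "is_triangle g n x x (compl g n ?u)"
      using doubling_triangle[OF n x(1-3)] \<delta> by simp_all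
    have "compl g n ?u \<in> W g n \<delta>" using uD by (intro mem_WI) simp_all
    then have "balanced (s x) (s x) (- s ?u)"
      using sign_patternD(3)[OF s xW(1) xW(1) _ T] cmp[OF u] by simp
    then show ?thesis by (rule balanced_double[OF _ vals[OF xW(1)] vals[OF u]])
  next
    case False
    have w: "omega x \<ge> 1" using omega_pos x by blast
    then have big: "omega x > \<delta>" using zdvd_imp_le[OF x(4)] False by simp
    obtain y z where T: "is_triangle g n y z (compl g n x)" and yz: "marks y = {}" "marks z = {}"
      "omega y = omega x - \<delta>" "omega z = \<delta>"
      by (rule splitting_triangle[OF n x(1-3), of "omega x - \<delta>" \<delta>]) (use big \<delta> in simp_all)
    have dom: "y \<in> stable_domain g n" "z \<in> stable_domain g n"
      using T by (simp_all add: is_triangle_def)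
    have e: "edges y \<ge> 2" "edges z \<ge> 2" using triangle_edges_ge2[OF T] by simp_all
    have dvd: "\<delta> dvd omega y" "\<delta> dvd omega z" using x(4) yz by simp_all
    have "s y = s ?u" "s z = s ?u"
      using less.hyps[of y] less.hyps[of z] dom e yz dvd big \<delta> by auto
    moreover have "y \<in> W g n \<delta>" "z \<in> W g n \<delta>" using dom e yz dvd by (simp_all add: mem_WI)
    ultimately have "balanced (s ?u) (s ?u) (- s x)"
      using sign_patternD(3)[OF s _ _ xW(2) T] cmp[OF xW(1)] by simp
    then show ?thesis using balanced_double vals[OF xW(1)] vals[OF u] by metis
  qed
qed

lemma rigid_W:
  assumes n: "n \<ge> 1" and \<delta>: "1 \<le> \<delta>" "\<delta> \<le> int g - 1"
  shows "rigid g n (W g n \<delta>)"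
proof -
  let ?s = "\<lambda>x. if marks x = {} then 1 else (-1 :: int)" and ?u = "with_omega 2 (2 * \<delta>) {}"
  have u: "?u \<in> W g n \<delta>" using \<delta> n by (intro mem_WI) (simp_all add: stable_domain_iff)
  have "sign_pattern g n (W g n \<delta>) ?s" by (rule empty_full_sign_pattern[OF n W_marks])
  moreover have "(\<forall>x\<in>W g n \<delta>. t x = 0) \<or> (\<forall>x\<in>W g n \<delta>. t x = ?s x) \<or> (\<forall>x\<in>W g n \<delta>. t x = - ?s x)"
    if t: "sign_pattern g n (W g n \<delta>) t" for t
  proof -
    have "t x = t ?u * ?s x" if xW: "x \<in> W g n \<delta>" for x
    proof -
      obtain y where y: "y \<in> stable_domain g n" "marks y = {}" "\<delta> dvd omega y" "edges y \<ge> 2"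
        and x: "x = y \<or> x = compl g n y" using xW unfolding mem_W_iff by blast
      have yW: "y \<in> W g n \<delta>" using y by (simp add: mem_WI)
      have "t y = t ?u" by (rule sign_pattern_W_constant[OF n \<delta> t y(1,2,4,3)])
      moreover have "{1..n} \<noteq> {}" using n by simp
      ultimately show ?thesis using x sign_patternD(2)[OF t yW] y(2) by auto
    qed
    moreover have "t ?u \<in> {-1, 0, 1}" by (rule sign_patternD(1)[OF t u])
    ultimately show ?thesis by auto
  qed
  moreover have "\<forall>y\<in>W g n \<delta>. ?s y \<noteq> 0" by simp
  ultimately show ?thesis unfolding rigid_def by blast
qed

section \<open>Degenerate unmarked sides form an arithmetic progression\<close>

text \<open>A parity argument. Both doubling triangles share their third element \<open>u\<close>, which is degenerate
  because \<open>x\<close> is. If \<open>y\<close> were nondegenerate, the two excesses would give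
  \<open>2 \<sigma> x + \<sigma> u = \<chi>\<close> and \<open>2 \<sigma> y + \<sigma> u = \<chi> + 1\<close>.\<close>

lemma V_equal_omega_degenerate:
  assumes n: "n \<ge> 1" and V: "\<sigma> \<in> V_functions g n \<chi>"
    and x: "x \<in> degeneracy g n \<chi> \<sigma>" "marks x = {}" "edges x \<ge> 2" "omega x \<le> int g - 1"
    and y: "y \<in> stable_domain g n" "marks y = {}" "edges y \<ge> 2" "omega y = omega x"
  shows "y \<in> degeneracy g n \<chi> \<sigma>"
proof (rule ccontr)
  assume yD: "y \<notin> degeneracy g n \<chi> \<sigma>"
  let ?u = "compl g n (with_omega 2 (2 * omega x) {})"
  have xdom: "x \<in> stable_domain g n" using x(1) degeneracy_subset by blast
  have Tx: "is_triangle g n x x ?u" by (rule doubling_triangle(2)[OF n xdom x(2-4)])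
  have Ty: "is_triangle g n y y ?u" using doubling_triangle(2)[OF n y(1-3)] x(4) y(4) by simp
  have u: "?u \<in> degeneracy g n \<chi> \<sigma>" by (rule degeneracy_triangle[OF V Tx x(1) x(1)])
  have "\<sigma> x + \<sigma> x + \<sigma> ?u - \<chi> = 0"
    using V_triangle[OF V Tx] x(1) u by (simp add: excess_rule_def)
  moreover have "\<sigma> y + \<sigma> y + \<sigma> ?u - \<chi> = 1"
    using V_triangle[OF V Ty] yD u by (simp add: excess_rule_def)
  ultimately show False by presburger
qed

text \<open>Degenerate unmarked sides of degree \<open>omega x\<close> and of a multiple of it make up a degenerate side,
  and by splitting every multiple is reached in this way.\<close>

lemma V_dvd_omega_degenerate:
  assumes n: "n \<ge> 1" and V: "\<sigma> \<in> V_functions g n \<chi>"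
    and x: "x \<in> degeneracy g n \<chi> \<sigma>" "marks x = {}" "edges x \<ge> 2" "omega x \<le> int g - 1"
    and "y \<in> stable_domain g n" "marks y = {}" "edges y \<ge> 2" "omega x dvd omega y"
  shows "y \<in> degeneracy g n \<chi> \<sigma>"
  using assms(7-)
proof (induction "nat (omega y)" arbitrary: y rule: less_induct)
  case less
  note y = less.prems
  have xdom: "x \<in> stable_domain g n" using x(1) degeneracy_subset by blast
  have w: "omega x \<ge> 1" "omega y \<ge> 1" using omega_pos xdom x y by blast+
  show ?case
  proof (cases "omega y = omega x")
    case True
    then show ?thesis by (rule V_equal_omega_degenerate[OF n V x y(1-3)])
  next
    case False
    then have big: "omega y > omega x" using zdvd_imp_le[OF y(4)] w by simp
    obtain p q where T: "is_triangle g n p q (compl g n y)" and pq: "marks p = {}" "marks q = {}"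
      "omega p = omega y - omega x" "omega q = omega x"
      by (rule splitting_triangle[OF n y(1-3), of "omega y - omega x" "omega x"])
        (use big w in simp_all)
    have dom: "p \<in> stable_domain g n" "q \<in> stable_domain g n"
      using T by (simp_all add: is_triangle_def)
    have e: "edges p \<ge> 2" "edges q \<ge> 2" using triangle_edges_ge2[OF T] by simp_all
    have "p \<in> degeneracy g n \<chi> \<sigma>"
      by (rule less.hyps) (use dom e pq y(4) w big in simp_all)
    moreover have "q \<in> degeneracy g n \<chi> \<sigma>"
      by (rule less.hyps) (use dom e pq y(4) w big in simp_all)
    ultimately have "compl g n y \<in> degeneracy g n \<chi> \<sigma>"
      using degeneracy_triangle[OF V T] by blast
    then show ?thesis using compl_mem_degeneracy_iff[OF y(1)] by blast
  qed
qed

text \<open>Euclidean descent: a part of the minimal degree can be split off from any larger degenerate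
  unmarked side, and the remaining part is degenerate again.\<close>

lemma V_min_omega_dvd:
  assumes n: "n \<ge> 1" and V: "\<sigma> \<in> V_functions g n \<chi>"
    and x: "x \<in> degeneracy g n \<chi> \<sigma>" "marks x = {}" "edges x \<ge> 2" "omega x \<le> int g - 1"
    and min: "\<And>y. y \<in> degeneracy g n \<chi> \<sigma> \<Longrightarrow> marks y = {} \<Longrightarrow> edges y \<ge> 2 \<Longrightarrow> omega x \<le> omega y"
    and "y \<in> degeneracy g n \<chi> \<sigma>" "marks y = {}" "edges y \<ge> 2"
  shows "omega x dvd omega y"
  using assms(8-)
proof (induction "nat (omega y)" arbitrary: y rule: less_induct)
  case less
  note y = less.prems
  have dom: "x \<in> stable_domain g n" "y \<in> stable_domain g n"
    using x(1) y(1) degeneracy_subset by blast+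
  have w: "omega x \<ge> 1" using omega_pos dom x by blast
  show ?case
  proof (cases "omega y = omega x")
    case False
    then have big: "omega y > omega x" using min[OF y] by simp
    obtain p q where T: "is_triangle g n p q (compl g n y)" and pq: "marks p = {}" "marks q = {}"
      "omega p = omega y - omega x" "omega q = omega x"
      by (rule splitting_triangle[OF n dom(2) y(2,3), of "omega y - omega x" "omega x"])
        (use big w in simp_all)
    have dom': "p \<in> stable_domain g n" "q \<in> stable_domain g n"
      using T by (simp_all add: is_triangle_def)
    have e: "edges p \<ge> 2" "edges q \<ge> 2" using triangle_edges_ge2[OF T] by simp_all
    have q: "q \<in> degeneracy g n \<chi> \<sigma>"
      by (rule V_equal_omega_degenerate[OF n V x dom'(2) pq(2) e(2) pq(4)])
    have T': "is_triangle g n q (compl g n y) p" using triangle_swap T by blast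
    have "compl g n y \<in> degeneracy g n \<chi> \<sigma>" using compl_mem_degeneracy_iff[OF dom(2)] y(1) by blast
    then have "p \<in> degeneracy g n \<chi> \<sigma>" by (rule degeneracy_triangle[OF V T' q])
    then have "omega x dvd omega p"
      by (intro less.hyps) (use e pq w big in simp_all)
    then show ?thesis using pq(3) dvd_add[of "omega x" "omega p" "omega x"] by simp
  qed simp
qed

section \<open>Classification of degeneracy subsets\<close>

text \<open>Lifting along a mixed pattern yields a strictly larger V-function that is still not general.\<close>

definition mixed_pattern :: "nat \<Rightarrow> nat \<Rightarrow> triple set \<Rightarrow> (triple \<Rightarrow> int) \<Rightarrow> bool" where
  "mixed_pattern g n D s \<longleftrightarrow> sign_pattern g n D s \<and> (\<exists>x\<in>D. s x = 0) \<and> (\<exists>x\<in>D. s x \<noteq> 0)"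

text \<open>A pair that meets no triangle inside \<open>D\<close> may be resolved while everything else is left alone.\<close>

lemma isolated_pair_mixed_pattern:
  assumes n: "n \<ge> 1" and D: "D \<subseteq> stable_domain g n" "\<And>y. y \<in> D \<Longrightarrow> compl g n y \<in> D"
    and x: "x \<in> D" and D_neq: "D \<noteq> {x, compl g n x}"
    and iso: "\<And>a b c. a \<in> D \<Longrightarrow> b \<in> D \<Longrightarrow> c \<in> D \<Longrightarrow> is_triangle g n a b c \<Longrightarrow>
      {a, b, c} \<inter> {x, compl g n x} = {}"
  shows "\<exists>s. mixed_pattern g n D s"
proof -
  let ?s = "\<lambda>y. if y = x then 1 else if y = compl g n x then -1 else (0 :: int)"
  have ne: "compl g n x \<noteq> x" by (rule compl_neq[OF n])
  have "sign_pattern g n D ?s"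
  proof (rule sign_patternI)
    show "?s (compl g n y) = - ?s y" if "y \<in> D" for y
    proof -
      have "y \<in> stable_domain g n" "x \<in> stable_domain g n" using that x D(1) by blast+
      then have "compl g n y = x \<longleftrightarrow> y = compl g n x" "compl g n y = compl g n x \<longleftrightarrow> y = x"
        using compl_compl by metis+
      then show ?thesis using ne by simp
    qed
    show "balanced (?s a) (?s b) (?s c)"
      if "a \<in> D" "b \<in> D" "c \<in> D" "is_triangle g n a b c" for a b c
    proof -
      have "?s a = 0" "?s b = 0" "?s c = 0" using iso[OF that] by auto
      then show ?thesis unfolding balanced_def by (simp only: insert_absorb2 simp_thms)
    qed
  qed simp
  moreover obtain y where "y \<in> D" "y \<noteq> x" "y \<noteq> compl g n x" using D_neq D(2) x by blast
  ultimately show ?thesis unfolding mixed_pattern_def using x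
    by (intro exI[of _ ?s] conjI bexI[of _ y] bexI[of _ x]) simp_all
qed

text \<open>Twisting by the divisor \<open>p_i - p_j\<close>: each of the two marked points lies on exactly one side of a
  triangle.\<close>

lemma separating_sign_pattern:
  assumes D: "D \<subseteq> stable_domain g n" and ij: "i \<in> {1..n}" "j \<in> {1..n}"
  shows "sign_pattern g n D (\<lambda>x. of_bool (i \<in> marks x) - of_bool (j \<in> marks x))"
proof (rule sign_patternI)
  show "balanced (of_bool (i \<in> marks x) - of_bool (j \<in> marks x))
      (of_bool (i \<in> marks y) - of_bool (j \<in> marks y)) (of_bool (i \<in> marks z) - of_bool (j \<in> marks z))"
    if T: "is_triangle g n x y z" for x y z
  proof -
    have one: "k \<in> marks x \<and> k \<notin> marks y \<and> k \<notin> marks z \<or> k \<notin> marks x \<and> k \<in> marks y \<and> k \<notin> marks z \<or>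
       k \<notin> marks x \<and> k \<notin> marks y \<and> k \<in> marks z" if "k \<in> {1..n}" for k
      using T that unfolding is_triangle_def by blast
    show ?thesis using one[OF ij(1)] one[OF ij(2)]
      by (elim disjE conjE) (simp_all add: balanced_def)
  qed
qed (use D ij in \<open>auto simp: of_bool_def\<close>)

text \<open>The clause of \<open>pair_sets\<close> for sides carrying all marks is the clause for unmarked sides, read on
  the complement.\<close>

lemma pair_setsI:
  assumes "x \<in> stable_domain g n"
    and "edges x = 1 \<or> ({} \<subset> marks x \<and> marks x \<subset> {1..n}) \<or> (marks x = {} \<and> omega x \<ge> int g)"
  shows "{x, compl g n x} \<in> pair_sets g n"
proof -
  obtain e h A where x: "x = (e, h, A)" by (cases x)
  show ?thesis
    unfolding pair_sets_def mem_Collect_eq x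
    by (intro exI[of _ e] exI[of _ h] exI[of _ A] conjI refl)
      (use assms in \<open>unfold x triple_simps, blast+\<close>)
qed

text \<open>One of the two elements of a pair avoids the first mark; choosing it turns full sides into
  unmarked ones.\<close>

lemma pair_setsE:
  assumes "P \<in> pair_sets g n" and n: "n \<ge> 1"
  obtains x where "x \<in> stable_domain g n" "P = {x, compl g n x}" "1 \<notin> marks x"
    "edges x = 1 \<or> ({} \<subset> marks x \<and> marks x \<subset> {1..n}) \<or> (marks x = {} \<and> omega x \<ge> int g)"
proof -
  obtain e h A where dom: "(e, h, A) \<in> stable_domain g n" and P: "P = {(e, h, A), compl g n (e, h, A)}"
    and c: "e = 1 \<or> ({} \<subset> A \<and> A \<subset> {1..n}) \<or> (A = {} \<and> 2 * h - 2 + e \<ge> int g) \<or>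
      (A = {1..n} \<and> 2 * h + e \<le> int g)"
    using assms(1) unfolding pair_sets_def by blast
  define x where "x = (e, h, A)"
  have x: "x \<in> stable_domain g n" "P = {x, compl g n x}" using dom P x_def by simp_all
  have sub: "marks x \<subseteq> {1..n}" using x(1) by (simp add: stable_domain_iff)
  have c: "edges x = 1 \<or> ({} \<subset> marks x \<and> marks x \<subset> {1..n}) \<or> (marks x = {} \<and> omega x \<ge> int g) \<or>
      (marks x = {1..n} \<and> omega (compl g n x) \<ge> int g)"
  proof -
    have "2 * h + e \<le> int g \<longleftrightarrow> omega (compl g n x) \<ge> int g" by (simp add: x_def) linarith
    with c show ?thesis by (simp only: x_def triple_simps)
  qed
  show thesis
  proof (cases "1 \<in> marks x")
    case False
    have "1 \<in> {1..n}" using n by simp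
    with False have "marks x \<noteq> {1..n}" by metis
    then show thesis using that[OF x False] c by blast
  next
    case True
    have "P = {compl g n x, compl g n (compl g n x)}" using x compl_compl by auto
    moreover have "edges (compl g n x) = 1 \<or>
        ({} \<subset> marks (compl g n x) \<and> marks (compl g n x) \<subset> {1..n}) \<or>
        (marks (compl g n x) = {} \<and> omega (compl g n x) \<ge> int g)"
    proof (cases "marks x = {1..n}")
      case False
      then have "{} \<subset> {1..n} - marks x" "{1..n} - marks x \<subset> {1..n}" using True sub by blast+
      then show ?thesis by simp
    next
      case full: True
      then show ?thesis using c n by auto
    qed
    ultimately show thesis
      using compl_in_domain[OF x(1)] True by (intro that[of "compl g n x"]) simp_all
  qed
qed

text \<open>Two of the elements are unmarked, and their degrees add up to at least \<open>2g\<close>, more than the total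
  \<open>2g - 2\<close>.\<close>

lemma no_triangle_large_omega:
  assumes n: "n \<ge> 1" and T: "is_triangle g n x y z"
    and v: "\<And>v. v \<in> {x, y, z} \<Longrightarrow> marks v \<in> {{}, {1..n}}"
      "\<And>v. v \<in> {x, y, z} \<Longrightarrow> marks v = {} \<Longrightarrow> omega v \<ge> int g"
  shows False
proof -
  have sum: "omega x + omega y + omega z = 2 * int g - 2" using T by (simp add: is_triangle_def)
  have nn: "omega x \<ge> 0" "omega y \<ge> 0" "omega z \<ge> 0"
    using T triangle_edges_ge2[OF T] by (simp_all add: is_triangle_def stable_domain_iff)
  have m: "marks x \<in> {{}, {1..n}}" "marks y \<in> {{}, {1..n}}" "marks z \<in> {{}, {1..n}}"
    using v(1) by blast+
  show False
    by (rule triangle_empty_full[OF n T m])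
      (use v(2)[of x] v(2)[of y] v(2)[of z] sum nn in simp_all)
qed

text \<open>The classification of degeneracy subsets \<open>D\<close> that cannot be reduced partially. If a complementary
  pair in \<open>D\<close> meets no triangle inside \<open>D\<close>, then \<open>D\<close> is this pair or has a mixed pattern.
  Together with the patterns separating two marks, this covers all cases except one: unmarked sides of degree less than \<open>g\<close> have doubling
  triangles, and there \<open>D\<close> is determined by its least degree.\<close>

theorem degeneracy_submaximal_or_mixed:
  assumes n: "n \<ge> 1" and V: "\<sigma> \<in> V_functions g n \<chi>" and ne: "degeneracy g n \<chi> \<sigma> \<noteq> {}"
  shows "degeneracy g n \<chi> \<sigma> \<in> pair_sets g n \<or>
     (\<exists>\<delta>. 1 \<le> \<delta> \<and> \<delta> \<le> int g - 1 \<and> degeneracy g n \<chi> \<sigma> = W g n \<delta>) \<or>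
     (\<exists>s. mixed_pattern g n (degeneracy g n \<chi> \<sigma>) s)"
proof -
  let ?D = "degeneracy g n \<chi> \<sigma>"
  have D: "?D \<subseteq> stable_domain g n" "\<And>y. y \<in> ?D \<Longrightarrow> compl g n y \<in> ?D"
    using degeneracy_subset compl_mem_degeneracy_iff by blast+
  have pair: "?D \<in> pair_sets g n \<or> (\<exists>s. mixed_pattern g n ?D s)"
    if x: "x \<in> ?D"
      and c: "edges x = 1 \<or> ({} \<subset> marks x \<and> marks x \<subset> {1..n}) \<or> (marks x = {} \<and> omega x \<ge> int g)"
      and iso: "\<And>a b c. a \<in> ?D \<Longrightarrow> b \<in> ?D \<Longrightarrow> c \<in> ?D \<Longrightarrow> is_triangle g n a b c \<Longrightarrow>
        {a, b, c} \<inter> {x, compl g n x} = {}" for x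
  proof (cases "?D = {x, compl g n x}")
    case True
    then show ?thesis using pair_setsI[OF _ c] x D(1) by auto
  next
    case False
    then show ?thesis using isolated_pair_mixed_pattern[OF n D x False iso] by blast
  qed
  show ?thesis
  proof (cases "\<exists>x\<in>?D. edges x = 1")
    case True
    then obtain x where x: "x \<in> ?D" "edges x = 1" by blast
    have "{a, b, c} \<inter> {x, compl g n x} = {}" if "is_triangle g n a b c" for a b c
      using triangle_edges_ge2[OF that] x(2) by force
    then show ?thesis using pair[OF x(1)] x(2) by blast
  next
    case False
    then have e2: "edges x \<ge> 2" if "x \<in> ?D" for x
      using that D(1) by (force simp: stable_domain_iff)
    show ?thesis
    proof (cases "\<exists>x\<in>?D. marks x \<notin> {{}, {1..n}}")
      case True
      then obtain x where x: "x \<in> ?D" "marks x \<noteq> {}" "marks x \<noteq> {1..n}" by blast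
      define A where "A = marks x"
      have A: "A \<subseteq> {1..n}" "A \<noteq> {}" "A \<noteq> {1..n}"
        using x(2,3) subsetD[OF D(1) x(1)] by (simp_all add: stable_domain_iff A_def)
      show ?thesis
      proof (cases "\<exists>s. mixed_pattern g n ?D s")
        case no_mixed: False
        \<comment> \<open>The pattern separating \<open>i\<close> from \<open>j\<close> is nonzero at \<open>x\<close>; not being mixed, it vanishes
  nowhere. Over all \<open>i\<close> and \<open>j\<close> this leaves no other mark sets than \<open>A\<close> and its complement.\<close>
        have sep: "i \<in> marks y \<longleftrightarrow> j \<notin> marks y" if "i \<in> A" "j \<in> {1..n} - A" "y \<in> ?D" for i j y
        proof -
          let ?s = "\<lambda>x. of_bool (i \<in> marks x) - of_bool (j \<in> marks x) :: int"
          have "sign_pattern g n ?D ?s"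
            by (rule separating_sign_pattern[OF D(1)]) (use that A(1) in auto)
          moreover have "?s x \<noteq> 0" using that A_def by simp
          ultimately have "?s y \<noteq> 0" using no_mixed x(1) that(3) unfolding mixed_pattern_def by blast
          then show ?thesis by (auto split: if_splits)
        qed
        have blocks: "marks y \<in> {A, {1..n} - A}" if "y \<in> ?D" for y
        proof -
          have sub: "marks y \<subseteq> {1..n}" using subsetD[OF D(1) that] by (simp add: stable_domain_iff)
          obtain i j where ij: "i \<in> A" "j \<in> {1..n} - A" using A by blast
          show ?thesis
          proof (cases "j \<in> marks y")
            case True
            then have "marks y = {1..n} - A" using sep[OF _ _ that] ij sub by blast
            then show ?thesis by simp
          next
            case False
            then have "marks y = A" using sep[OF _ _ that] ij sub by blast
            then show ?thesis by simp
          qed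
        qed
        have "\<not> is_triangle g n a b c" if "a \<in> ?D" "b \<in> ?D" "c \<in> ?D" for a b c
          using no_triangle_two_blocks[OF _ A blocks[OF that(1)] blocks[OF that(2)] blocks[OF that(3)]]
          by blast
        then show ?thesis using pair[OF x(1)] A unfolding A_def by blast
      qed blast
    next
      case False
      then have ef: "marks x \<in> {{}, {1..n}}" if "x \<in> ?D" for x using that by blast
      \<comment> \<open>All sides in \<open>D\<close> are now unmarked or carry all the marks; the least degree of an unmarked one decides.\<close>
      define E where "E = {x \<in> ?D. marks x = {}}"
      obtain x0 where "x0 \<in> ?D" using ne by blast
      then have "x0 \<in> E \<or> compl g n x0 \<in> E" using ef[of x0] D(2)[of x0] unfolding E_def by auto
      then have "E \<noteq> {}" by blast
      then obtain x where x: "x \<in> E" and min: "\<And>y. y \<in> E \<Longrightarrow> nat (omega x) \<le> nat (omega y)"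
        using ex_has_least_nat[of "\<lambda>y. y \<in> E" _ "\<lambda>y. nat (omega y)"] by blast
      have xD: "x \<in> ?D" "marks x = {}" using x by (simp_all add: E_def)
      have wpos: "omega y \<ge> 1" if "y \<in> ?D" "marks y = {}" for y
        using that D(1) omega_pos by blast
      have min: "omega x \<le> omega y" if "y \<in> ?D" "marks y = {}" for y
        using min[of y] that wpos[OF that] by (simp add: E_def)
      show ?thesis
      proof (cases "omega x \<ge> int g")
        case True
        have "\<not> is_triangle g n a b c" if "a \<in> ?D" "b \<in> ?D" "c \<in> ?D" for a b c
        proof
          assume T: "is_triangle g n a b c"
          have "v \<in> ?D" if "v \<in> {a, b, c}" for v using that \<open>a \<in> ?D\<close> \<open>b \<in> ?D\<close> \<open>c \<in> ?D\<close> by blast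
          from no_triangle_large_omega[OF n T ef[OF this] order_trans[OF True min[OF this]]]
          show False by blast
        qed
        then show ?thesis using pair[OF xD(1)] xD(2) True by blast
      next
        case False
        then have le: "omega x \<le> int g - 1" by simp
        have "?D = W g n (omega x)"
        proof (intro set_eqI iffI)
          fix y assume y: "y \<in> ?D"
          have *: "z \<in> W g n (omega x) \<and> compl g n z \<in> W g n (omega x)"
            if "z \<in> ?D" "marks z = {}" for z
            using V_min_omega_dvd[OF n V xD e2[OF xD(1)] le min that e2[OF that(1)]]
            by (intro conjI mem_WI subsetD[OF D(1) that(1)] that(2) e2[OF that(1)]) simp_all
          show "y \<in> W g n (omega x)"
          proof (cases "marks y = {}")
            case True
            then show ?thesis using *[OF y] by blast
          next
            case False
            then have "marks (compl g n y) = {}" using ef[OF y] by simp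
            then have "compl g n (compl g n y) \<in> W g n (omega x)" using *[OF D(2)[OF y]] by blast
            then show ?thesis using compl_compl y D(1) by (metis subsetD)
          qed
        next
          fix y assume "y \<in> W g n (omega x)"
          then obtain z where z: "z \<in> stable_domain g n" "marks z = {}" "omega x dvd omega z"
            "edges z \<ge> 2" "y = z \<or> y = compl g n z" unfolding mem_W_iff by blast
          have "z \<in> ?D" by (rule V_dvd_omega_degenerate[OF n V xD e2[OF xD(1)] le z(1,2,4,3)])
          then show "y \<in> ?D" using z(5) D(2) by blast
        qed
        then show ?thesis using wpos[OF xD] le by blast
      qed
    qed
  qed
qed

section \<open>Maximal and submaximal V-functions\<close>

text \<open>The sets that turn out to be the degeneracy subsets of submaximal V-functions.\<close>

abbreviation submaximal_locus :: "nat \<Rightarrow> nat \<Rightarrow> triple set \<Rightarrow> bool" where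
  "submaximal_locus g n D \<equiv> D \<in> pair_sets g n \<or> (\<exists>\<delta>. 1 \<le> \<delta> \<and> \<delta> \<le> int g - 1 \<and> D = W g n \<delta>)"

lemma submaximal_locus_rigid:
  assumes n: "n \<ge> 1" and "submaximal_locus g n D"
  shows "D \<noteq> {}" "rigid g n D"
proof -
  have "D \<noteq> {} \<and> rigid g n D"
    using assms(2)
  proof (elim disjE exE conjE)
    assume "D \<in> pair_sets g n"
    then obtain x where "x \<in> stable_domain g n" "D = {x, compl g n x}"
      by (rule pair_setsE[OF _ n])
    then show ?thesis using rigid_pair[OF n] by blast
  next
    fix \<delta> assume \<delta>: "1 \<le> \<delta>" "\<delta> \<le> int g - 1" "D = W g n \<delta>"
    have "with_omega 2 (2 * \<delta>) {} \<in> W g n \<delta>"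
      using \<delta> n by (intro mem_WI) (simp_all add: stable_domain_iff)
    then show ?thesis using rigid_W[OF n \<delta>(1,2)] \<delta>(3) by blast
  qed
  then show "D \<noteq> {}" "rigid g n D" by blast+
qed

lemma lift_strictly_above:
  assumes V: "\<sigma> \<in> V_functions g n \<chi>" and s: "sign_pattern g n (degeneracy g n \<chi> \<sigma>) s"
    and x: "x \<in> degeneracy g n \<chi> \<sigma>" "s x \<noteq> 0"
  shows "V_less g n \<sigma> (lift g n \<chi> \<sigma> s)"
proof -
  have "x \<notin> degeneracy g n \<chi> (lift g n \<chi> \<sigma> s)" using lift_V(2)[OF V s] x(2) by simp
  then have "\<sigma> \<noteq> lift g n \<chi> \<sigma> s" using x(1) by metis
  then show ?thesis using lift_V(3)[OF V s] by (simp add: V_less_def)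
qed

text \<open>A nonempty degeneracy subset always carries a nonzero sign pattern, mixed or not, and lifting
  along it shows that the V-function is not maximal.\<close>

lemma maximal_iff_general:
  assumes n: "n \<ge> 1"
  shows "\<sigma> \<in> maximal_V g n \<chi> \<longleftrightarrow> \<sigma> \<in> V_functions g n \<chi> \<and> degeneracy g n \<chi> \<sigma> = {}"
proof (intro iffI conjI)
  assume max: "\<sigma> \<in> maximal_V g n \<chi>"
  then show V: "\<sigma> \<in> V_functions g n \<chi>" by (simp add: maximal_V_def)
  show "degeneracy g n \<chi> \<sigma> = {}"
  proof (rule ccontr)
    assume ne: "degeneracy g n \<chi> \<sigma> \<noteq> {}"
    obtain s x where "sign_pattern g n (degeneracy g n \<chi> \<sigma>) s" "x \<in> degeneracy g n \<chi> \<sigma>" "s x \<noteq> 0"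
    proof (cases "submaximal_locus g n (degeneracy g n \<chi> \<sigma>)")
      case True
      then show thesis using submaximal_locus_rigid[OF n True] that unfolding rigid_def by blast
    next
      case False
      then show thesis using degeneracy_submaximal_or_mixed[OF n V ne] that
        unfolding mixed_pattern_def by blast
    qed
    then show False using lift_strictly_above[OF V] lift_V(1)[OF V] max
      unfolding maximal_V_def by blast
  qed
next
  assume "\<sigma> \<in> V_functions g n \<chi> \<and> degeneracy g n \<chi> \<sigma> = {}"
  then show "\<sigma> \<in> maximal_V g n \<chi>"
    using V_above_general_eq unfolding maximal_V_def V_less_def by blast
qed

text \<open>The only V-functions above \<open>\<sigma>\<close> are its lifts along \<open>0\<close>, \<open>s\<close> and \<open>-s\<close>. The first is \<open>\<sigma>\<close>
  itself, and the other two are general.\<close>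

lemma rigid_submaximal:
  assumes n: "n \<ge> 1" and V: "\<sigma> \<in> V_functions g n \<chi>"
    and ne: "degeneracy g n \<chi> \<sigma> \<noteq> {}" and rigid: "rigid g n (degeneracy g n \<chi> \<sigma>)"
  shows "\<sigma> \<in> submaximal_V g n \<chi>" "card {\<tau> \<in> maximal_V g n \<chi>. V_le g n \<sigma> \<tau>} = 2"
proof -
  let ?D = "degeneracy g n \<chi> \<sigma>" and ?L = "lift g n \<chi> \<sigma>"
  obtain s where s: "sign_pattern g n ?D s" "\<forall>x\<in>?D. s x \<noteq> 0"
    and only: "\<And>t. sign_pattern g n ?D t \<Longrightarrow>
        (\<forall>x\<in>?D. t x = 0) \<or> (\<forall>x\<in>?D. t x = s x) \<or> (\<forall>x\<in>?D. t x = - s x)"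
    using rigid unfolding rigid_def by blast
  let ?s' = "\<lambda>x. - s x"
  have s': "sign_pattern g n ?D ?s'" by (rule sign_pattern_uminus[OF s(1)])
  have max: "?L s \<in> maximal_V g n \<chi>" "?L ?s' \<in> maximal_V g n \<chi>"
    using lift_V(1,2)[OF V s(1)] lift_V(1,2)[OF V s'] s(2) by (simp_all add: maximal_iff_general[OF n])
  have above: "\<tau> = \<sigma> \<or> \<tau> = ?L s \<or> \<tau> = ?L ?s'"
    if \<tau>: "\<tau> \<in> V_functions g n \<chi>" "V_le g n \<sigma> \<tau>" for \<tau>
  proof -
    obtain t where t: "sign_pattern g n ?D t" "\<tau> = ?L t"
      by (rule V_le_obtain_sign_pattern[OF V \<tau>])
    have cong: "?L t = ?L r" if "\<forall>x\<in>?D. t x = r x" for r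
      using that by (intro ext) (simp add: lift_def cong: conj_cong)
    have "?L (\<lambda>x. 0) = \<sigma>" by (intro ext) (simp add: lift_def)
    then show ?thesis using only[OF t(1)] cong[of "\<lambda>x. 0"] cong[of s] cong[of ?s'] t(2) by metis
  qed
  have not_max: "\<sigma> \<notin> maximal_V g n \<chi>" using ne by (simp add: maximal_iff_general[OF n])
  show "\<sigma> \<in> submaximal_V g n \<chi>"
    using V not_max above max unfolding submaximal_V_def V_less_def by blast
  have "{\<tau> \<in> maximal_V g n \<chi>. V_le g n \<sigma> \<tau>} = {?L s, ?L ?s'}"
  proof (intro set_eqI iffI)
    fix \<tau> assume "\<tau> \<in> {\<tau> \<in> maximal_V g n \<chi>. V_le g n \<sigma> \<tau>}"
    then show "\<tau> \<in> {?L s, ?L ?s'}" using above not_max unfolding maximal_V_def by blast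
  next
    fix \<tau> assume "\<tau> \<in> {?L s, ?L ?s'}"
    then show "\<tau> \<in> {\<tau> \<in> maximal_V g n \<chi>. V_le g n \<sigma> \<tau>}"
      using max lift_V(3)[OF V s(1)] lift_V(3)[OF V s'] by blast
  qed
  moreover have "?L s \<noteq> ?L ?s'"
  proof -
    obtain x where x: "x \<in> ?D" using ne by blast
    have "s x \<in> {-1, 1}" using sign_patternD(1)[OF s(1) x] s(2) x by blast
    then have "?L s x \<noteq> ?L ?s' x" using x by (auto simp: lift_def)
    then show ?thesis by metis
  qed
  ultimately show "card {\<tau> \<in> maximal_V g n \<chi>. V_le g n \<sigma> \<tau>} = 2" by simp
qed

lemma submaximal_iff_locus:
  assumes n: "n \<ge> 1"
  shows "\<sigma> \<in> submaximal_V g n \<chi> \<longleftrightarrow> \<sigma> \<in> V_functions g n \<chi> \<and> submaximal_locus g n (degeneracy g n \<chi> \<sigma>)"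
proof
  assume sub: "\<sigma> \<in> submaximal_V g n \<chi>"
  then have V: "\<sigma> \<in> V_functions g n \<chi>" and ne: "degeneracy g n \<chi> \<sigma> \<noteq> {}"
    by (auto simp: submaximal_V_def maximal_iff_general[OF n])
  have "\<not> mixed_pattern g n (degeneracy g n \<chi> \<sigma>) s" for s
  proof
    assume "mixed_pattern g n (degeneracy g n \<chi> \<sigma>) s"
    then obtain x y where s: "sign_pattern g n (degeneracy g n \<chi> \<sigma>) s"
      and x: "x \<in> degeneracy g n \<chi> \<sigma>" "s x = 0" and y: "y \<in> degeneracy g n \<chi> \<sigma>" "s y \<noteq> 0"
      unfolding mixed_pattern_def by blast
    have "lift g n \<chi> \<sigma> s \<in> maximal_V g n \<chi>"
      using sub lift_V(1)[OF V s] lift_strictly_above[OF V s y] unfolding submaximal_V_def by blast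
    then show False using lift_V(2)[OF V s] x maximal_iff_general[OF n] by blast
  qed
  then show "\<sigma> \<in> V_functions g n \<chi> \<and> submaximal_locus g n (degeneracy g n \<chi> \<sigma>)"
    using V degeneracy_submaximal_or_mixed[OF n V ne] by blast
next
  assume "\<sigma> \<in> V_functions g n \<chi> \<and> submaximal_locus g n (degeneracy g n \<chi> \<sigma>)"
  then have V: "\<sigma> \<in> V_functions g n \<chi>" and "submaximal_locus g n (degeneracy g n \<chi> \<sigma>)"
    by (rule conjunct1, rule conjunct2)
  from submaximal_locus_rigid[OF n this(2)] show "\<sigma> \<in> submaximal_V g n \<chi>"
    by (rule rigid_submaximal(1)[OF n V])
qed

section \<open>V-functions from numerical stability conditions\<close>

text \<open>Outside \<open>Z\<close> each pair is resolved, say towards the element containing the first mark. Since all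
  triangles inside the degeneracy subset lie in \<open>Z\<close>, where the pattern is zero, any such choice
  is a sign pattern.\<close>

lemma prune_degeneracy:
  assumes n: "n \<ge> 1" and V: "\<sigma> \<in> V_functions g n \<chi>"
    and Z: "Z \<subseteq> degeneracy g n \<chi> \<sigma>" "\<And>x. x \<in> Z \<Longrightarrow> compl g n x \<in> Z"
    and tri: "\<And>x y z. x \<in> degeneracy g n \<chi> \<sigma> \<Longrightarrow> y \<in> degeneracy g n \<chi> \<sigma> \<Longrightarrow>
      z \<in> degeneracy g n \<chi> \<sigma> \<Longrightarrow> is_triangle g n x y z \<Longrightarrow> {x, y, z} \<subseteq> Z"
  shows "\<exists>\<tau> \<in> V_functions g n \<chi>. degeneracy g n \<chi> \<tau> = Z"
proof -
  let ?D = "degeneracy g n \<chi> \<sigma>"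
  let ?s = "\<lambda>x. if x \<in> Z then 0 else if 1 \<in> marks x then 1 else (-1 :: int)"
  have "sign_pattern g n ?D ?s"
  proof (rule sign_patternI)
    show "?s (compl g n x) = - ?s x" if "x \<in> ?D" for x
    proof -
      have "compl g n (compl g n x) = x" using that degeneracy_subset compl_compl by blast
      then have "compl g n x \<in> Z \<longleftrightarrow> x \<in> Z" using Z(2) by metis
      then show ?thesis using one_mem_marks_compl[OF n] by simp
    qed
    show "balanced (?s x) (?s y) (?s z)"
      if "x \<in> ?D" "y \<in> ?D" "z \<in> ?D" "is_triangle g n x y z" for x y z
      using tri[OF that] by (simp add: balanced_def)
  qed simp
  from lift_V(1,2)[OF V this] Z(1) show ?thesis
    by (intro bexI[of _ "lift g n \<chi> \<sigma> ?s"]) auto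
qed

text \<open>The V-function of a numerical stability condition: the ceiling of the rational additive function
  with value \<open>(a * omega x + sum b (marks x)) / M\<close>. Elements with one edge, which lie in no
  triangle, are all made degenerate, to be resolved later as required.\<close>

definition rounded :: "nat \<Rightarrow> nat \<Rightarrow> int \<Rightarrow> int \<Rightarrow> int \<Rightarrow> (nat \<Rightarrow> int) \<Rightarrow> triple \<Rightarrow> int" where
  "rounded g n \<chi> M a b = restrict (\<lambda>x. if edges x = 1 then (if 1 \<in> marks x then \<chi> else 0)
     else - ((- (a * omega x + sum b (marks x))) div M)) (stable_domain g n)"

text \<open>\<open>- ((- N) div M)\<close> is the ceiling of \<open>N / M\<close>, and \<open>r\<close> measures how far it is rounded up.\<close>

lemma ceiling_div:
  fixes M N :: int
  assumes "M > 0"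
  obtains r where "N = M * (- ((- N) div M)) - r" "0 \<le> r" "r < M" "M dvd N \<longleftrightarrow> r = 0"
proof -
  have "M dvd N \<longleftrightarrow> (- N) mod M = 0" by (simp add: dvd_eq_mod_eq_0[symmetric])
  moreover have "N = M * (- ((- N) div M)) - (- N) mod M"
    using mult_div_mod_eq[of M "- N"] unfolding mult_minus_right by linarith
  ultimately show thesis using that assms by simp
qed

text \<open>The excess is the sum of the three rounding errors divided by \<open>M\<close>, hence an integer that is at
  least \<open>0\<close> and less than \<open>3\<close>; an error is zero exactly at degenerate elements.\<close>

lemma residues_excess_rule:
  fixes M k p q r :: int
  assumes "M * k = p + q + r" "0 \<le> p" "p < M" "0 \<le> q" "q < M" "0 \<le> r" "r < M"
  shows "excess_rule (p = 0) (q = 0) (r = 0) k"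
proof -
  have "M * k < M * 3" "M * (-1) < M * k" "M > 0" using assms by linarith+
  then have "k < 3" "-1 < k" by (simp_all only: mult_less_cancel_left_pos)
  then consider "k = 0" "p + q + r = 0" | "k = 1" "p + q + r = M" | "k = 2" "p + q + r = 2 * M"
    using assms(1) by (cases "k = 0"; cases "k = 1"; cases "k = 2") simp_all
  then show ?thesis by cases (use assms(2-) in \<open>auto simp: excess_rule_def\<close>)
qed

text \<open>The same for two rounding errors, as a triple whose third error is zero.\<close>

lemma residues_pair:
  fixes M k p q :: int
  assumes "M * k = p + q" "0 \<le> p" "p < M" "0 \<le> q" "q < M"
  shows "k = of_bool (p \<noteq> 0)"
proof -
  have "excess_rule (p = 0) (q = 0) True k"
    using residues_excess_rule[of M k p q 0] assms by simp
  then show ?thesis by (auto simp: excess_rule_def split: if_splits)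
qed

lemma rounded_V:
  assumes n: "n \<ge> 1" and M: "M > 0" and total: "a * (2 * int g - 2) + sum b {1..n} = \<chi> * M"
  shows "rounded g n \<chi> M a b \<in> V_functions g n \<chi>"
    and "degeneracy g n \<chi> (rounded g n \<chi> M a b) =
      {x \<in> stable_domain g n. edges x = 1 \<or> M dvd a * omega x + sum b (marks x)}"
proof -
  let ?\<sigma> = "rounded g n \<chi> M a b" and ?N = "\<lambda>x. a * omega x + sum b (marks x)"
  have pair: "?\<sigma> x + ?\<sigma> (compl g n x) - \<chi> = of_bool (\<not> (edges x = 1 \<or> M dvd ?N x))"
    if x: "x \<in> stable_domain g n" for x
  proof (cases "edges x = 1")
    case True
    then show ?thesis
      using x compl_in_domain[OF x] one_mem_marks_compl[OF n] by (simp add: rounded_def)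
  next
    case False
    have sub: "marks x \<subseteq> {1..n}" using x by (simp add: stable_domain_iff)
    have sum: "?N x + ?N (compl g n x) = M * \<chi>"
      using total sum.subset_diff[OF sub, of b] by (simp add: algebra_simps)
    obtain r where r: "?N x = M * ?\<sigma> x - r" "0 \<le> r" "r < M" "M dvd ?N x \<longleftrightarrow> r = 0"
      using ceiling_div[OF M, of "?N x"] x False unfolding rounded_def by auto
    obtain r' where r': "?N (compl g n x) = M * ?\<sigma> (compl g n x) - r'" "0 \<le> r'" "r' < M"
      using ceiling_div[OF M, of "?N (compl g n x)"] compl_in_domain[OF x] False
      unfolding rounded_def by auto
    have eq: "M * (?\<sigma> x + ?\<sigma> (compl g n x) - \<chi>) = r + r'"
      using sum r(1) r'(1) by (simp add: algebra_simps)
    have "?\<sigma> x + ?\<sigma> (compl g n x) - \<chi> = of_bool (r \<noteq> 0)"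
      by (rule residues_pair[OF eq r(2,3) r'(2,3)])
    then show ?thesis using r(4) False by simp
  qed
  have deg: "degenerate g n \<chi> ?\<sigma> x \<longleftrightarrow> edges x = 1 \<or> M dvd ?N x" if "x \<in> stable_domain g n" for x
    using pair[OF that] by (simp add: degenerate_def)
  show "degeneracy g n \<chi> ?\<sigma> = {x \<in> stable_domain g n. edges x = 1 \<or> M dvd ?N x}"
    using deg by (auto simp only: degeneracy_def)
  have "excess_rule (degenerate g n \<chi> ?\<sigma> x) (degenerate g n \<chi> ?\<sigma> y) (degenerate g n \<chi> ?\<sigma> z)
      (?\<sigma> x + ?\<sigma> y + ?\<sigma> z - \<chi>)" if T: "is_triangle g n x y z" for x y z
  proof -
    have dom: "x \<in> stable_domain g n" "y \<in> stable_domain g n" "z \<in> stable_domain g n"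
      using T by (simp_all add: is_triangle_def)
    have e: "edges x \<noteq> 1" "edges y \<noteq> 1" "edges z \<noteq> 1" using triangle_edges_ge2[OF T] by simp_all
    have rep: "\<exists>r. ?N v = M * ?\<sigma> v - r \<and> 0 \<le> r \<and> r < M \<and> (degenerate g n \<chi> ?\<sigma> v \<longleftrightarrow> r = 0)"
      if v: "v \<in> stable_domain g n" "edges v \<noteq> 1" for v
    proof -
      obtain r where "?N v = M * (- ((- ?N v) div M)) - r" "0 \<le> r" "r < M" "M dvd ?N v \<longleftrightarrow> r = 0"
        by (rule ceiling_div[OF M])
      then show ?thesis using v deg[OF v(1)] by (intro exI[of _ r]) (simp add: rounded_def)
    qed
    obtain p where p: "?N x = M * ?\<sigma> x - p" "0 \<le> p" "p < M" "degenerate g n \<chi> ?\<sigma> x \<longleftrightarrow> p = 0"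
      using rep[OF dom(1) e(1)] by blast
    obtain q where q: "?N y = M * ?\<sigma> y - q" "0 \<le> q" "q < M" "degenerate g n \<chi> ?\<sigma> y \<longleftrightarrow> q = 0"
      using rep[OF dom(2) e(2)] by blast
    obtain r where r: "?N z = M * ?\<sigma> z - r" "0 \<le> r" "r < M" "degenerate g n \<chi> ?\<sigma> z \<longleftrightarrow> r = 0"
      using rep[OF dom(3) e(3)] by blast
    have fin: "finite (marks v)" if "v \<in> stable_domain g n" for v
      using that finite_subset[of "marks v" "{1..n}"] by (simp add: stable_domain_iff)
    have "sum b {1..n} = sum b (marks x) + sum b (marks y) + sum b (marks z)"
    proof -
      have m: "{1..n} = (marks x \<union> marks y) \<union> marks z" "marks x \<inter> marks y = {}"
        "(marks x \<union> marks y) \<inter> marks z = {}" using T unfolding is_triangle_def by blast+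
      show ?thesis unfolding m(1) using m(2,3) fin dom by (simp add: sum.union_disjoint)
    qed
    moreover have "a * omega x + a * omega y + a * omega z = a * (2 * int g - 2)"
      using T unfolding is_triangle_def by (metis distrib_left)
    ultimately have "?N x + ?N y + ?N z = M * \<chi>" using total by (simp add: mult.commute)
    then have eq: "M * (?\<sigma> x + ?\<sigma> y + ?\<sigma> z - \<chi>) = p + q + r"
      using p(1) q(1) r(1) by (simp add: algebra_simps)
    from residues_excess_rule[OF this p(2,3) q(2,3) r(2,3)]
    show ?thesis unfolding p(4) q(4) r(4) .
  qed
  moreover have "?\<sigma> \<in> extensional (stable_domain g n)" by (simp add: rounded_def)
  moreover have "\<forall>x\<in>stable_domain g n. ?\<sigma> x + ?\<sigma> (compl g n x) - \<chi> \<in> {0, 1}"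
    using pair by (simp add: of_bool_def)
  ultimately show "?\<sigma> \<in> V_functions g n \<chi>" unfolding V_functions_iff by blast
qed

section \<open>Realization of the degeneracy subsets\<close>

lemma set_encode_less: "B \<subseteq> {1..n} \<Longrightarrow> set_encode B < 2 ^ (n + 1)"
proof -
  assume "B \<subseteq> {1..n}"
  then have "set_encode B \<le> (\<Sum>i = 0..<n + 1. 2 ^ i)"
    unfolding set_encode_def by (intro sum_mono2) auto
  also have "\<dots> < 2 ^ (n + 1)" by (simp only: sum_power2) simp
  finally show ?thesis .
qed

text \<open>Weighting mark \<open>i\<close> by \<open>2 ^ i\<close> encodes the pair of degree and mark set in one integer.
  The weight of \<open>p\<close> can be corrected by any \<open>c\<close>, which will serve to make a prescribed element
  degenerate. The weight of the first mark is used up to adjust the total to \<open>\<chi> * M\<close>; for this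
  reason degeneracy is described only for elements avoiding that mark, one in each
  complementary pair.\<close>

lemma coded_V_function:
  assumes n: "n \<ge> 1" and M: "M > 0" and p: "p \<noteq> 1"
  obtains \<sigma> where "\<sigma> \<in> V_functions g n \<chi>"
    "\<And>x. x \<in> stable_domain g n \<Longrightarrow> 1 \<notin> marks x \<Longrightarrow> x \<in> degeneracy g n \<chi> \<sigma> \<longleftrightarrow>
       edges x = 1 \<or> M dvd 2 ^ (n + 1) * omega x + int (set_encode (marks x)) - of_bool (p \<in> marks x) * c"
proof -
  define b where "b R i = 2 ^ i - (if i = p then c else 0) + (if i = 1 then R else 0)" for R :: int and i :: nat
  have sum_b: "sum (b R) B = int (set_encode B) - of_bool (p \<in> B) * c + of_bool (1 \<in> B) * R"
    if "finite B" for R B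
    using that by (simp add: b_def set_encode_def sum.distrib sum_subtractf)
  define R where "R = \<chi> * M - 2 ^ (n + 1) * (2 * int g - 2) - sum (b 0) {1..n}"
  have total: "2 ^ (n + 1) * (2 * int g - 2) + sum (b R) {1..n} = \<chi> * M"
    using sum_b[of "{1..n}" R] sum_b[of "{1..n}" 0] n by (simp add: R_def)
  show thesis
  proof (rule that[of "rounded g n \<chi> M (2 ^ (n + 1)) (b R)"])
    show "rounded g n \<chi> M (2 ^ (n + 1)) (b R) \<in> V_functions g n \<chi>"
      by (rule rounded_V(1)[OF n M total])
    fix x assume x: "x \<in> stable_domain g n" "1 \<notin> marks x"
    have "finite (marks x)"
      using x(1) finite_subset[of "marks x" "{1..n}"] by (simp add: stable_domain_iff)
    then have eq: "2 ^ (n + 1) * omega x + sum (b R) (marks x) =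
        2 ^ (n + 1) * omega x + int (set_encode (marks x)) - of_bool (p \<in> marks x) * c"
      using sum_b x(2) by simp
    show "x \<in> degeneracy g n \<chi> (rounded g n \<chi> M (2 ^ (n + 1)) (b R)) \<longleftrightarrow> edges x = 1 \<or>
        M dvd 2 ^ (n + 1) * omega x + int (set_encode (marks x)) - of_bool (p \<in> marks x) * c"
      by (simp only: rounded_V(2)[OF n M total] mem_Collect_eq eq x(1) simp_thms)
  qed
qed

lemma set_encode_dvd_diff:
  assumes "A \<subseteq> {1..n}" "B \<subseteq> {1..n}" "2 ^ (n + 1) dvd int (set_encode B) - int (set_encode A)"
  shows "B = A"
proof -
  have bound: "int (set_encode A) < 2 ^ (n + 1)" "int (set_encode B) < 2 ^ (n + 1)"
    using set_encode_less[OF assms(1)] set_encode_less[OF assms(2)]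
    by (metis of_nat_less_iff of_nat_numeral of_nat_power)+
  have "int (set_encode B) mod 2 ^ (n + 1) = int (set_encode A) mod 2 ^ (n + 1)"
    using assms(3) by (simp add: mod_eq_dvd_iff)
  then have "set_encode B = set_encode A" using bound by simp
  moreover have "finite A" "finite B" using assms finite_subset by blast+
  ultimately show ?thesis by (simp add: set_encode_eq)
qed

text \<open>Divide the code by \<open>2 ^ (n + 1) * \<delta>\<close>. The lower \<open>n + 1\<close> binary digits of a code encode the mark set,
  so divisibility forces the side to be unmarked and its degree to be a multiple of \<open>\<delta>\<close>.\<close>

lemma W_and_bridges_degenerate:
  assumes n: "n \<ge> 1" and \<delta>: "\<delta> \<ge> 1"
  obtains \<sigma> where "\<sigma> \<in> V_functions g n \<chi>"
    "degeneracy g n \<chi> \<sigma> = {x \<in> stable_domain g n. edges x = 1} \<union> W g n \<delta>"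
proof -
  let ?K = "2 ^ (n + 1) :: int"
  have "?K * \<delta> > 0" using \<delta> by simp
  then obtain \<sigma> where V: "\<sigma> \<in> V_functions g n \<chi>" and deg: "\<And>x. x \<in> stable_domain g n \<Longrightarrow>
      1 \<notin> marks x \<Longrightarrow> x \<in> degeneracy g n \<chi> \<sigma> \<longleftrightarrow>
      edges x = 1 \<or> ?K * \<delta> dvd ?K * omega x + int (set_encode (marks x)) - of_bool (0 \<in> marks x) * 0"
    by (rule coded_V_function[OF n, where p = 0 and c = 0 and g = g and \<chi> = \<chi>]) (simp, blast)
  \<comment> \<open>Both sets are closed under complements, so it suffices to compare them on elements avoiding the first mark.\<close>
  let ?R = "{x \<in> stable_domain g n. edges x = 1} \<union> W g n \<delta>"
  have one: "x \<in> degeneracy g n \<chi> \<sigma> \<longleftrightarrow> x \<in> ?R" if x: "x \<in> stable_domain g n" "1 \<notin> marks x" for x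
  proof -
    have sub: "marks x \<subseteq> {1..n}" and e: "edges x \<ge> 1" using x(1) by (simp_all add: stable_domain_iff)
    have "?K * \<delta> dvd ?K * omega x + int (set_encode (marks x)) \<longleftrightarrow> marks x = {} \<and> \<delta> dvd omega x"
    proof
      assume dvd: "?K * \<delta> dvd ?K * omega x + int (set_encode (marks x))"
      then have "?K dvd ?K * omega x + int (set_encode (marks x))" by (rule dvd_mult_left)
      then have "?K dvd int (set_encode (marks x)) - int (set_encode {})"
        by (simp add: dvd_add_right_iff)
      then have "marks x = {}" by (intro set_encode_dvd_diff[OF _ sub]) simp_all
      then show "marks x = {} \<and> \<delta> dvd omega x" using dvd by simp
    qed simp
    moreover have "x \<in> W g n \<delta> \<longleftrightarrow> marks x = {} \<and> \<delta> dvd omega x \<and> edges x \<ge> 2"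
    proof
      assume "x \<in> W g n \<delta>"
      then obtain y where "marks y = {}" "\<delta> dvd omega y" "edges y \<ge> 2" "x = y \<or> x = compl g n y"
        unfolding mem_W_iff by blast
      then show "marks x = {} \<and> \<delta> dvd omega x \<and> edges x \<ge> 2" using x(2) n by auto
    qed (use mem_WI(1)[OF x(1)] in blast)
    ultimately show ?thesis using deg[OF x] x(1) e by auto
  qed
  have W_compl: "compl g n x \<in> W g n \<delta>" if "x \<in> W g n \<delta>" for x
    using that compl_compl unfolding mem_W_iff by metis
  have compl_R: "compl g n x \<in> ?R \<longleftrightarrow> x \<in> ?R" if "x \<in> stable_domain g n" for x
    using that W_compl[of x] W_compl[of "compl g n x"] compl_compl[OF that] compl_in_domain[OF that]
    by auto
  have "degeneracy g n \<chi> \<sigma> = ?R"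
  proof (rule set_eqI)
    fix x
    show "x \<in> degeneracy g n \<chi> \<sigma> \<longleftrightarrow> x \<in> ?R"
    proof (cases "x \<in> stable_domain g n")
      case dom: True
      show ?thesis
      proof (cases "1 \<in> marks x")
        case True
        then have "compl g n x \<in> degeneracy g n \<chi> \<sigma> \<longleftrightarrow> compl g n x \<in> ?R"
          by (intro one compl_in_domain[OF dom]) simp
        then show ?thesis using compl_R[OF dom] compl_mem_degeneracy_iff[OF dom] by blast
      qed (rule one[OF dom])
    next
      case False
      then show ?thesis using degeneracy_subset[of g n \<chi> \<sigma>] W_subset[of g n \<delta>] by blast
    qed
  qed
  with V show thesis by (rule that)
qed

lemma W_realized:
  assumes n: "n \<ge> 1" and \<delta>: "\<delta> \<ge> 1"
  shows "\<exists>\<sigma> \<in> V_functions g n \<chi>. degeneracy g n \<chi> \<sigma> = W g n \<delta>"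
proof -
  obtain \<sigma> where V: "\<sigma> \<in> V_functions g n \<chi>"
    and D: "degeneracy g n \<chi> \<sigma> = {x \<in> stable_domain g n. edges x = 1} \<union> W g n \<delta>"
    by (rule W_and_bridges_degenerate[OF n \<delta>])
  show ?thesis
  proof (rule prune_degeneracy[OF n V])
    show "W g n \<delta> \<subseteq> degeneracy g n \<chi> \<sigma>" using D by blast
    show "compl g n x \<in> W g n \<delta>" if "x \<in> W g n \<delta>" for x
      using that compl_compl unfolding mem_W_iff by metis
    show "{x, y, z} \<subseteq> W g n \<delta>"
      if "x \<in> degeneracy g n \<chi> \<sigma>" "y \<in> degeneracy g n \<chi> \<sigma>" "z \<in> degeneracy g n \<chi> \<sigma>"
        "is_triangle g n x y z" for x y z
      using that(1-3) triangle_edges_ge2[OF that(4)] unfolding D by auto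
  qed
qed

lemma isolated_pair_realized:
  assumes n: "n \<ge> 1" and V: "\<sigma> \<in> V_functions g n \<chi>" and x: "x \<in> degeneracy g n \<chi> \<sigma>"
    and no: "\<And>a b c. a \<in> degeneracy g n \<chi> \<sigma> \<Longrightarrow> b \<in> degeneracy g n \<chi> \<sigma> \<Longrightarrow>
      c \<in> degeneracy g n \<chi> \<sigma> \<Longrightarrow> \<not> is_triangle g n a b c"
  shows "\<exists>\<tau> \<in> V_functions g n \<chi>. degeneracy g n \<chi> \<tau> = {x, compl g n x}"
proof (rule prune_degeneracy[OF n V])
  have dom: "x \<in> stable_domain g n" using x degeneracy_subset by blast
  show "{x, compl g n x} \<subseteq> degeneracy g n \<chi> \<sigma>" using x compl_mem_degeneracy_iff[OF dom] by blast
  show "compl g n y \<in> {x, compl g n x}" if "y \<in> {x, compl g n x}" for y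
    using that compl_compl[OF dom] by blast
qed (use no in blast)

text \<open>The previous V-function with \<open>\<delta> \<ge> g\<close> has no triangle among its degenerate elements, so it can be
  pruned to any of its degenerate pairs.\<close>

lemma bridge_or_large_pair_realized:
  assumes n: "n \<ge> 1" and x: "x \<in> stable_domain g n"
    and c: "edges x = 1 \<or> marks x = {} \<and> omega x \<ge> int g"
  shows "\<exists>\<tau> \<in> V_functions g n \<chi>. degeneracy g n \<chi> \<tau> = {x, compl g n x}"
proof -
  obtain \<delta> where \<delta>: "\<delta> \<ge> 1" "\<delta> \<ge> int g" "edges x = 1 \<or> marks x = {} \<and> omega x = \<delta>"
  proof (cases "edges x = 1")
    case True
    then show thesis by (intro that[of "int g + 1"]) simp_all
  next
    case False
    then show thesis using c omega_pos[OF x] by (intro that[of "omega x"]) simp_all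
  qed
  obtain \<sigma> where V: "\<sigma> \<in> V_functions g n \<chi>"
    and D: "degeneracy g n \<chi> \<sigma> = {x \<in> stable_domain g n. edges x = 1} \<union> W g n \<delta>"
    by (rule W_and_bridges_degenerate[OF n \<delta>(1)])
  have e: "edges x \<ge> 1" using x by (simp add: stable_domain_iff)
  have xD: "x \<in> degeneracy g n \<chi> \<sigma>"
  proof (cases "edges x = 1")
    case False
    then show ?thesis unfolding D using \<delta>(3) x e by (intro UnI2 mem_WI) simp_all
  qed (use D x in blast)
  have ne: "{1..n} \<noteq> {}" using n by simp
  have W: "marks v \<in> {{}, {1..n}} \<and> (marks v = {} \<longrightarrow> omega v \<ge> int g)" if v: "v \<in> W g n \<delta>" for v
  proof -
    obtain y where y: "y \<in> stable_domain g n" "marks y = {}" "\<delta> dvd omega y" "v = y \<or> v = compl g n y"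
      using v unfolding mem_W_iff by blast
    have "omega y \<ge> \<delta>" using zdvd_imp_le[OF y(3)] omega_pos[OF y(1,2)] by simp
    then show ?thesis using y(2,4) \<delta>(2) ne by auto
  qed
  show ?thesis
  proof (rule isolated_pair_realized[OF n V xD], rule notI)
    fix a b c assume D3: "a \<in> degeneracy g n \<chi> \<sigma>" "b \<in> degeneracy g n \<chi> \<sigma>" "c \<in> degeneracy g n \<chi> \<sigma>"
      and T: "is_triangle g n a b c"
    have "v \<in> W g n \<delta>" if "v \<in> {a, b, c}" for v
      using that D3 triangle_edges_ge2[OF T] unfolding D by auto
    then show False using no_triangle_large_omega[OF n T] W by blast
  qed
qed

text \<open>Choose \<open>p\<close> in the mark set \<open>A\<close> of \<open>x\<close> and let the correction of its weight be the code of \<open>x\<close>, so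
  that \<open>x\<close> gets the value zero. Modulo \<open>2 ^ (n + 1)\<close> only the mark sets \<open>A\<close> and \<open>{}\<close> remain
  among those avoiding the first mark. The modulus \<open>2 ^ (n + 1) * (2g + 1)\<close> rules out \<open>{}\<close>,
  because the degree of an unmarked side with at least two edges lies between \<open>1\<close> and
  \<open>2g - 2\<close>. Hence no degenerate elements form a triangle, and the pair of \<open>x\<close> can be isolated.\<close>

lemma proper_pair_realized:
  assumes n: "n \<ge> 1" and x: "x \<in> stable_domain g n" "marks x \<noteq> {}" "1 \<notin> marks x"
  shows "\<exists>\<tau> \<in> V_functions g n \<chi>. degeneracy g n \<chi> \<tau> = {x, compl g n x}"
proof -
  obtain p where p: "p \<in> marks x" using x(2) by blast
  let ?K = "2 ^ (n + 1) :: int" and ?A = "marks x"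
  let ?c = "?K * omega x + int (set_encode ?A)"
  have p1: "p \<noteq> 1" using p x(3) by metis
  have M: "?K * (2 * int g + 1) > 0" by simp
  obtain \<sigma> where V: "\<sigma> \<in> V_functions g n \<chi>" and deg: "\<And>y. y \<in> stable_domain g n \<Longrightarrow>
      1 \<notin> marks y \<Longrightarrow> y \<in> degeneracy g n \<chi> \<sigma> \<longleftrightarrow> edges y = 1 \<or> ?K * (2 * int g + 1) dvd
        ?K * omega y + int (set_encode (marks y)) - of_bool (p \<in> marks y) * ?c"
    by (rule coded_V_function[OF n M p1, where c = ?c and g = g and \<chi> = \<chi>]) blast
  have xD: "x \<in> degeneracy g n \<chi> \<sigma>" using deg[OF x(1,3)] p by simp
  have A: "?A \<subseteq> {1..n}" "?A \<noteq> {1..n}"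
    using x(1,3) n by (auto simp: stable_domain_iff)
  have one: "marks y = ?A" if y: "y \<in> degeneracy g n \<chi> \<sigma>" "1 \<notin> marks y" "edges y \<ge> 2" for y
  proof -
    have dom: "y \<in> stable_domain g n" using y(1) degeneracy_subset by blast
    have sub: "marks y \<subseteq> {1..n}" and w: "0 \<le> omega y" "omega y \<le> 2 * int g"
      using dom y(3) by (simp_all add: stable_domain_iff)
    have dvd: "?K * (2 * int g + 1) dvd
        ?K * omega y + int (set_encode (marks y)) - of_bool (p \<in> marks y) * ?c"
      using deg[OF dom y(2)] y(1,3) by simp
    have K: "?K dvd ?K * omega y + int (set_encode (marks y)) - of_bool (p \<in> marks y) * ?c"
      using dvd by (rule dvd_mult_left)
    show ?thesis
    proof (cases "p \<in> marks y")
      case True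
      then have "?K dvd ?K * (omega y - omega x) + (int (set_encode (marks y)) - int (set_encode ?A))"
        using K by (simp add: algebra_simps)
      then have "?K dvd int (set_encode (marks y)) - int (set_encode ?A)"
        by (subst (asm) dvd_add_right_iff) simp_all
      then show ?thesis by (rule set_encode_dvd_diff[OF A(1) sub])
    next
      case False
      then have "?K dvd int (set_encode (marks y)) - int (set_encode {})"
        using K by (simp add: dvd_add_right_iff)
      then have m: "marks y = {}" by (intro set_encode_dvd_diff[OF _ sub]) simp_all
      then have "2 * int g + 1 dvd omega y" using dvd by simp
      moreover have "omega y \<ge> 1" by (rule omega_pos[OF dom m])
      ultimately show ?thesis using zdvd_imp_le[of "2 * int g + 1" "omega y"] w by simp
    qed
  qed
  have blocks: "marks y \<in> {?A, {1..n} - ?A}" if y: "y \<in> degeneracy g n \<chi> \<sigma>" "edges y \<ge> 2" for y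
  proof (cases "1 \<in> marks y")
    case False
    then show ?thesis using one[OF y(1) _ y(2)] by blast
  next
    case True
    have dom: "y \<in> stable_domain g n" using y(1) degeneracy_subset by blast
    have "{1..n} - marks y = ?A"
      using one[of "compl g n y"] True y compl_mem_degeneracy_iff[OF dom] by simp
    moreover have "marks y \<subseteq> {1..n}" using dom by (simp add: stable_domain_iff)
    ultimately show ?thesis by (metis double_diff order_refl insertCI)
  qed
  show ?thesis
  proof (rule isolated_pair_realized[OF n V xD], rule notI)
    fix a b c assume D: "a \<in> degeneracy g n \<chi> \<sigma>" "b \<in> degeneracy g n \<chi> \<sigma>" "c \<in> degeneracy g n \<chi> \<sigma>"
      and T: "is_triangle g n a b c"
    have e: "edges a \<ge> 2" "edges b \<ge> 2" "edges c \<ge> 2" using triangle_edges_ge2[OF T] by simp_all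
    show False
      by (rule no_triangle_two_blocks[OF T A(1) x(2) A(2) blocks[OF D(1) e(1)] blocks[OF D(2) e(2)]
            blocks[OF D(3) e(3)]])
  qed
qed

lemma pair_realized:
  assumes n: "n \<ge> 1" and P: "P \<in> pair_sets g n"
  shows "\<exists>\<sigma> \<in> V_functions g n \<chi>. degeneracy g n \<chi> \<sigma> = P"
proof -
  obtain x where x: "x \<in> stable_domain g n" "P = {x, compl g n x}" "1 \<notin> marks x"
    "edges x = 1 \<or> ({} \<subset> marks x \<and> marks x \<subset> {1..n}) \<or> (marks x = {} \<and> omega x \<ge> int g)"
    by (rule pair_setsE[OF P n])
  show ?thesis
  proof (cases "marks x = {}")
    case True
    then show ?thesis using bridge_or_large_pair_realized[OF n x(1)] x(2,4) by blast
  next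
    case False
    then show ?thesis using proper_pair_realized[OF n x(1) _ x(3)] x(2) by blast
  qed
qed

section \<open>The top of the poset of V-functions\<close>

theorem theorem7:
  fixes g n :: nat and \<chi> :: int
  assumes "n \<ge> 1" and "2 * int g - 2 + int n > 0"
  shows "maximal_V g n \<chi> = {\<sigma> \<in> V_functions g n \<chi>. degeneracy g n \<chi> \<sigma> = {}}
    \<and> submaximal_V g n \<chi> = {\<sigma> \<in> V_functions g n \<chi>.
          degeneracy g n \<chi> \<sigma> \<in> pair_sets g n \<or>
          (\<exists>\<delta>. 1 \<le> \<delta> \<and> \<delta> \<le> int g - 1 \<and> degeneracy g n \<chi> \<sigma> = W g n \<delta>)}
    \<and> (\<forall>P \<in> pair_sets g n. \<exists>\<sigma> \<in> V_functions g n \<chi>. degeneracy g n \<chi> \<sigma> = P)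
    \<and> (\<forall>\<delta>. 1 \<le> \<delta> \<and> \<delta> \<le> int g - 1 \<longrightarrow> (\<exists>\<sigma> \<in> V_functions g n \<chi>. degeneracy g n \<chi> \<sigma> = W g n \<delta>))
    \<and> (\<forall>\<sigma> \<in> submaximal_V g n \<chi>. card {\<tau> \<in> maximal_V g n \<chi>. V_le g n \<sigma> \<tau>} = 2)"
proof (intro conjI)
  note n = assms(1)
  show "maximal_V g n \<chi> = {\<sigma> \<in> V_functions g n \<chi>. degeneracy g n \<chi> \<sigma> = {}}"
    by (intro set_eqI) (simp only: maximal_iff_general[OF n] mem_Collect_eq)
  show "submaximal_V g n \<chi> = {\<sigma> \<in> V_functions g n \<chi>. submaximal_locus g n (degeneracy g n \<chi> \<sigma>)}"
    by (intro set_eqI) (simp only: submaximal_iff_locus[OF n] mem_Collect_eq)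
  show "\<forall>P \<in> pair_sets g n. \<exists>\<sigma> \<in> V_functions g n \<chi>. degeneracy g n \<chi> \<sigma> = P"
    using pair_realized[OF n] by (intro ballI)
  show "\<forall>\<delta>. 1 \<le> \<delta> \<and> \<delta> \<le> int g - 1 \<longrightarrow> (\<exists>\<sigma> \<in> V_functions g n \<chi>. degeneracy g n \<chi> \<sigma> = W g n \<delta>)"
    using W_realized[OF n] by (intro allI impI) (elim conjE)
  show "\<forall>\<sigma> \<in> submaximal_V g n \<chi>. card {\<tau> \<in> maximal_V g n \<chi>. V_le g n \<sigma> \<tau>} = 2"
  proof
    fix \<sigma> assume "\<sigma> \<in> submaximal_V g n \<chi>"
    then have V: "\<sigma> \<in> V_functions g n \<chi>" and "submaximal_locus g n (degeneracy g n \<chi> \<sigma>)"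
      unfolding submaximal_iff_locus[OF n] by (rule conjunct1, rule conjunct2)
    from submaximal_locus_rigid[OF n this(2)] show "card {\<tau> \<in> maximal_V g n \<chi>. V_le g n \<sigma> \<tau>} = 2"
      by (rule rigid_submaximal(2)[OF n V])
  qed
qed

end
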